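(* Let $N\ge2$, $1<p<\infty$, and $R>0$. Let $B_R$ be the open ball of radius $R$ centered at the origin in $\mathbb R^N$. Then \[ \lambda_{1,p}(B_R)>N\lambda_{1,p}((-R,R))=N(p-1)\left(\frac{\pi_p}{2R}\right)^p. \]
   Context: For a bounded domain $\Omega\subset\mathbb R^n$ and $1<p<\infty$, the first Dirichlet eigenvalue of the $p$-Laplacian is \[ \lambda_{1,p}(\Omega)=\inf_{u\in W_0^{1,p}(\Omega)\setminus\{0\}}\frac{\int_\Omega|\nabla u|^p\,dx}{\int_\Omega|u|^p\,dx}. \] The constant $\pi_p$ is defined by \[ \pi_p:=2\int_0^1\frac{d\tau}{(1-\tau^p)^{1/p}}. \] *)

theory Defs
  imports "HOL-Analysis.Analysis"
begin

definition partial_deriv :: "('a::euclidean_space \<Rightarrow> real) \<Rightarrow> 'a \<Rightarrow> 'a \<Rightarrow> real" where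
  "partial_deriv f b x = frechet_derivative f (at x) b"

definition grad :: "('a::euclidean_space \<Rightarrow> real) \<Rightarrow> 'a \<Rightarrow> 'a" where
  "grad f x = (\<Sum>b\<in>Basis. partial_deriv f b x *\<^sub>R b)"

primrec Ck :: "nat \<Rightarrow> ('a::euclidean_space \<Rightarrow> real) \<Rightarrow> bool" where
  "Ck 0 f \<longleftrightarrow> continuous_on UNIV f"
| "Ck (Suc k) f \<longleftrightarrow> (\<forall>x. f differentiable (at x)) \<and> (\<forall>b\<in>Basis. Ck k (partial_deriv f b))"

text \<open>The elements of \<open>C\<^sub>c\<^sup>\<infinity>(\<Omega>)\<close>, extended by zero to the whole space.\<close>

definition test_function :: "'a::euclidean_space set \<Rightarrow> ('a \<Rightarrow> real) \<Rightarrow> bool" where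
  "test_function \<Omega> f \<longleftrightarrow>
     (\<forall>k. Ck k f) \<and> compact (closure {x. f x \<noteq> 0}) \<and> closure {x. f x \<noteq> 0} \<subseteq> \<Omega>"

definition Lp :: "real \<Rightarrow> 'a::euclidean_space set \<Rightarrow> ('a \<Rightarrow> 'b::euclidean_space) \<Rightarrow> bool" where
  "Lp p \<Omega> f \<longleftrightarrow> f \<in> borel_measurable (lebesgue_on \<Omega>) \<and>
     integrable (lebesgue_on \<Omega>) (\<lambda>x. norm (f x) powr p)"

definition weak_gradient ::
    "'a::euclidean_space set \<Rightarrow> ('a \<Rightarrow> real) \<Rightarrow> ('a \<Rightarrow> 'a) \<Rightarrow> bool" where
  "weak_gradient \<Omega> u g \<longleftrightarrow> (\<forall>f b. test_function \<Omega> f \<longrightarrow> b \<in> Basis \<longrightarrow>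
     (LINT x|lebesgue_on \<Omega>. u x * partial_deriv f b x) =
     - (LINT x|lebesgue_on \<Omega>. (g x \<bullet> b) * f x))"

text \<open>Weak gradients are determined only up to null sets, so Sobolev functions are handled as
  pairs \<open>(u, g)\<close> with \<open>g\<close> a version of the weak gradient of \<open>u\<close>.\<close>

definition W1p :: "real \<Rightarrow> 'a::euclidean_space set \<Rightarrow> (('a \<Rightarrow> real) \<times> ('a \<Rightarrow> 'a)) set" where
  "W1p p \<Omega> = {(u, g). Lp p \<Omega> u \<and> Lp p \<Omega> g \<and> weak_gradient \<Omega> u g}"

text \<open>The closure of \<open>C\<^sub>c\<^sup>\<infinity>(\<Omega>)\<close> in \<open>W\<^sup>1\<^sup>,\<^sup>p(\<Omega>)\<close>; convergence is expressed by the \<open>p\<close>-th power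
  of the norm. The integrals below are finite, all functions involved being in \<open>L\<^sup>p\<close>.\<close>

definition W01p :: "real \<Rightarrow> 'a::euclidean_space set \<Rightarrow> (('a \<Rightarrow> real) \<times> ('a \<Rightarrow> 'a)) set" where
  "W01p p \<Omega> = {(u, g) \<in> W1p p \<Omega>. \<exists>\<phi>::nat \<Rightarrow> 'a \<Rightarrow> real. (\<forall>k. test_function \<Omega> (\<phi> k)) \<and>
     (\<lambda>k. (LINT x|lebesgue_on \<Omega>. \<bar>u x - \<phi> k x\<bar> powr p) +
          (LINT x|lebesgue_on \<Omega>. norm (g x - grad (\<phi> k) x) powr p)) \<longlonglongrightarrow> 0}"

text \<open>``Nonzero'' means nonzero as an element of \<open>L\<^sup>p\<close>, i.e. not almost everywhere zero.\<close>

definition first_eigenvalue :: "real \<Rightarrow> 'a::euclidean_space set \<Rightarrow> real" where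
  "first_eigenvalue p \<Omega> = Inf {(LINT x|lebesgue_on \<Omega>. norm (g x) powr p) /
       (LINT x|lebesgue_on \<Omega>. \<bar>u x\<bar> powr p) | u g.
     (u, g) \<in> W01p p \<Omega> \<and> \<not> (AE x in lebesgue_on \<Omega>. u x = 0)}"

definition pi_p :: "real \<Rightarrow> real" where
  "pi_p p = 2 * (LBINT t=0..1. 1 / (1 - t powr p) powr (1 / p))"

end

theory Submission
  imports Defs "HOL-Real_Asymp.Real_Asymp"
begin

text \<open>Write \<open>q = p / (p - 1)\<close>. Let \<open>H\<close> be the solution of \<open>H' = l + (p - 1) * \<bar>H\<bar> powr q\<close>,
  \<open>H 0 = 0\<close>; it blows up exactly at \<open>R\<close> when \<open>l = (p - 1) * (pi_p p / (2 * R)) powr p\<close>. By Picone's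
  (Barta's) argument a vector field \<open>F\<close> with \<open>- div F \<ge> \<mu> + (p - 1) * norm F powr q\<close> shows that the
  first eigenvalue is at least \<open>\<mu>\<close>. On the interval \<open>F = - H\<close> gives \<open>l\<close>, which is attained by
  \<open>H' powr (- 1 / p)\<close>. On the ball \<open>F = - H (norm x) * x / norm x\<close> gives
  \<open>l + (N - 1) * H r / r\<close>, and \<open>H r / r > l\<close> for \<open>r > 0\<close> because \<open>H' > l\<close>; a small perturbation of
  \<open>F\<close> makes the gain uniform up to the origin.\<close>

section \<open>Smooth functions\<close>

text \<open>\<open>H\<close> is the Riccati transform - \<bar>v'\<bar> powr (p - 2) * v' / v powr (p
  - 1) of the positive first eigenfunction v of the interval: the second-order equation for v
  becomes first-order, and the zeros of v at the ends become blow-up. The new equation is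
  autonomous, so separation of variables reduces it to inverting one integral, which a substitution
  ties to \<open>pi_p\<close>. The product of H' and v powr p is a first integral; normalised to 1
  it gives the formula for v in terms of H'.

  Strictness on the ball is the obstacle: a barrier that is strict at each point yields only a weak
  inequality between infima, so a single constant above N * l has to work for all radii. Since H r /
  r tends to l at the origin, the unperturbed field offers no such constant.

  Lower bounds are proved for test functions, whose compact support avoids the singularity of
  \<open>H\<close> at R, and then carried to \<open>W01p\<close> by approximation. For the upper
  bound v is not itself placed in \<open>W01p\<close>: smooth approximations of v' are integrated
  into test functions, and their quotients converge to that of v.\<close>

lemma partial_deriv_eq:
  assumes "(f has_derivative f') (at x)"
  shows "partial_deriv f b x = f' b"
  using frechet_derivative_at[OF assms] by (simp add: partial_deriv_def)

lemma Ck_SucI: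
  assumes "\<And>x. (f has_derivative f' x) (at x)" "\<And>b. b \<in> Basis \<Longrightarrow> Ck k (\<lambda>x. f' x b)"
  shows "Ck (Suc k) f"
proof -
  have "partial_deriv f b = (\<lambda>x. f' x b)" for b
    using partial_deriv_eq[OF assms(1)] by blast
  then show ?thesis using assms by (auto simp: differentiable_def)
qed

lemma Ck_Suc_has_derivative:
  assumes "Ck (Suc k) f"
  shows "(f has_derivative (\<lambda>h. partial_deriv f h x)) (at x)"
  using assms frechet_derivative_works[of f "at x"] by (simp add: partial_deriv_def)

lemma Ck_mono_Suc: "Ck (Suc k) f \<Longrightarrow> Ck k f"
proof (induction k arbitrary: f)
  case 0
  then show ?case
    by (auto simp: continuous_on_eq_continuous_at intro: differentiable_imp_continuous_within)
qed auto

lemma Ck_continuous: "Ck k f \<Longrightarrow> continuous_on UNIV f"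
  by (induction k) (use Ck_mono_Suc in auto)

lemma Ck_const: "Ck k (\<lambda>x. c)"
proof (induction k arbitrary: c)
  case (Suc k)
  show ?case by (rule Ck_SucI[where f' = "\<lambda>_ _. 0"]) (use Suc in auto)
qed auto

lemma Ck_linear: "bounded_linear f \<Longrightarrow> Ck k f"
proof (cases k)
  case (Suc k)
  assume "bounded_linear f"
  then show ?thesis unfolding Suc
    by (intro Ck_SucI[where f' = "\<lambda>_. f"]) (auto intro: bounded_linear_imp_has_derivative Ck_const)
qed (auto intro: linear_continuous_on)

lemma Ck_add: "Ck k f \<Longrightarrow> Ck k g \<Longrightarrow> Ck k (\<lambda>x. f x + g x)"
proof (induction k arbitrary: f g)
  case (Suc k)
  show ?case
    by (rule Ck_SucI[where f' = "\<lambda>x h. partial_deriv f h x + partial_deriv g h x"])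
      (use Suc in \<open>auto intro!: has_derivative_add Ck_Suc_has_derivative Suc.IH simp del: Ck.simps(2)\<close>,
       use Suc in auto)
qed (auto intro: continuous_on_add)

lemma Ck_mult: "Ck k f \<Longrightarrow> Ck k g \<Longrightarrow> Ck k (\<lambda>x. f x * g x)"
proof (induction k arbitrary: f g)
  case (Suc k)
  show ?case
  proof (rule Ck_SucI[where f' = "\<lambda>x h. f x * partial_deriv g h x + partial_deriv f h x * g x"])
    show "((\<lambda>x. f x * g x) has_derivative (\<lambda>h. f x * partial_deriv g h x + partial_deriv f h x * g x)) (at x)" for x
      using Suc.prems by (intro has_derivative_mult Ck_Suc_has_derivative)
    show "Ck k (\<lambda>x. f x * partial_deriv g b x + partial_deriv f b x * g x)" if "b \<in> Basis" for b
      using Suc.prems that Ck_mono_Suc[OF Suc.prems(1)] Ck_mono_Suc[OF Suc.prems(2)]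
      by (auto intro!: Ck_add Suc.IH)
  qed
qed (auto intro: continuous_on_mult)

lemma Ck_sum: "finite A \<Longrightarrow> (\<And>a. a \<in> A \<Longrightarrow> Ck k (f a)) \<Longrightarrow> Ck k (\<lambda>x. \<Sum>a\<in>A. f a x)"
  by (induction A rule: finite_induct) (auto intro: Ck_add Ck_const)

lemma Ck_norm_square: "Ck k (\<lambda>x. (norm x)\<^sup>2)"
proof -
  have "(norm x)\<^sup>2 = (\<Sum>b\<in>Basis. (x \<bullet> b) * (x \<bullet> b))" for x :: 'a
    by (simp only: power2_norm_eq_inner euclidean_inner[symmetric])
  then show ?thesis
    by (simp add: Ck_sum Ck_mult Ck_linear bounded_linear_inner_left)
qed

lemma Ck_real_polynomial_function: "real_polynomial_function f \<Longrightarrow> Ck k f"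
  by (induction rule: real_polynomial_function.induct) (auto intro: Ck_linear Ck_const Ck_add Ck_mult)

text \<open>All derivatives of the flat function \<open>exp (-1/t)\<close> have this form.\<close>

definition flat_exp :: "real poly \<Rightarrow> real \<Rightarrow> real" where
  "flat_exp P t = (if t > 0 then poly P (1/t) * exp (-1/t) else 0)"

lemma tendsto_poly_times_exp: "((\<lambda>s::real. poly P s * exp (-s)) \<longlongrightarrow> 0) at_top"
proof -
  have "poly P s * exp (-s) = (\<Sum>i\<le>degree P. coeff P i * (s ^ i / exp s))" for s
    by (simp add: poly_altdef sum_distrib_right exp_minus divide_simps)
  moreover have "((\<lambda>s::real. \<Sum>i\<le>degree P. coeff P i * (s ^ i / exp s)) \<longlongrightarrow> (\<Sum>i\<le>degree P. coeff P i * 0)) at_top"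
    by (intro tendsto_intros tendsto_power_div_exp_0)
  ultimately show ?thesis by simp
qed

text \<open>With s = 1/t one has d/dt = - s^2 d/ds, and d/ds sends P(s) exp(-s) to (P' - P)(s)
  exp(-s); this is the new polynomial. At t = 0 the difference quotient from the right is s P(s)
  exp(-s) with s tending to infinity, where the exponential wins.\<close>

lemma flat_exp_has_derivative:
  "(flat_exp P has_real_derivative flat_exp ([:0, 0, 1:] * (P - pderiv P)) t) (at t)"
proof -
  consider "t > 0" | "t < 0" | "t = 0" by linarith
  then show ?thesis
  proof cases
    case 1
    have "((\<lambda>t. poly P (1/t) * exp (-1/t)) has_real_derivative
        flat_exp ([:0, 0, 1:] * (P - pderiv P)) t) (at t)"
    proof -
      have "((\<lambda>t. 1/t) has_real_derivative - (1/t)\<^sup>2) (at t)"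
        using 1 by (auto intro!: derivative_eq_intros simp: power2_eq_square)
      from DERIV_mult[OF DERIV_chain2[OF poly_DERIV this] DERIV_chain2[OF DERIV_exp DERIV_minus[OF this]]]
      show ?thesis using 1 by (simp add: flat_exp_def algebra_simps power2_eq_square)
    qed
    moreover have "\<forall>\<^sub>F s in nhds t. flat_exp P s = poly P (1/s) * exp (-1/s)"
      using eventually_nhds_in_open[of "{0<..}" t] 1
      by (auto elim!: eventually_mono simp: flat_exp_def)
    ultimately show ?thesis
      by (subst DERIV_cong_ev[OF refl _ refl])
  next
    case 2
    have "\<forall>\<^sub>F s in nhds t. flat_exp P s = 0"
      using eventually_nhds_in_open[of "{..<0}" t] 2
      by (auto elim!: eventually_mono simp: flat_exp_def)
    then have "(flat_exp P has_real_derivative 0) (at t)"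
      by (subst DERIV_cong_ev[OF refl _ refl]) auto
    then show ?thesis using 2 by (simp add: flat_exp_def)
  next
    case 3
    have "((\<lambda>h. flat_exp P h / h) \<longlongrightarrow> 0) (at 0)"
    proof (rule filterlim_split_at)
      show "((\<lambda>h. flat_exp P h / h) \<longlongrightarrow> 0) (at_left 0)"
        by (rule tendsto_eventually) (auto simp: flat_exp_def eventually_at_filter)
      have "((\<lambda>h. poly (pCons 0 P) (inverse h) * exp (- inverse h)) \<longlongrightarrow> 0) (at_right 0)"
        by (rule filterlim_compose[OF tendsto_poly_times_exp filterlim_inverse_at_top_right])
      then show "((\<lambda>h. flat_exp P h / h) \<longlongrightarrow> 0) (at_right 0)"
        by (rule Lim_transform_eventually) (auto simp: flat_exp_def eventually_at_filter field_simps)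
    qed
    then show ?thesis
      using 3 by (simp add: has_field_derivative_iff flat_exp_def)
  qed
qed

text \<open>Each derivative replaces \<open>P\<close> by another polynomial, so \<open>P\<close> is
  generalised in the induction; each step also uses up one derivative of \<open>q\<close>.\<close>

lemma Ck_flat_exp:
  assumes "\<And>j. Ck j q"
  shows "Ck k (\<lambda>x. flat_exp P (q x))"
proof (induction k arbitrary: P)
  case 0
  have "continuous_on UNIV (flat_exp P)"
    by (simp add: continuous_on_eq_continuous_at DERIV_isCont[OF flat_exp_has_derivative])
  then show ?case
    using Ck_continuous[OF assms[of 0]] continuous_on_compose2[of UNIV "flat_exp P" UNIV q] by auto
next
  case (Suc k)
  show ?case
  proof (rule Ck_SucI)
    show "((\<lambda>x. flat_exp P (q x)) has_derivative
       (\<lambda>h. partial_deriv q h x * flat_exp ([:0, 0, 1:] * (P - pderiv P)) (q x))) (at x)" for x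
      by (rule DERIV_compose_FDERIV[OF flat_exp_has_derivative Ck_Suc_has_derivative[OF assms]])
    show "Ck k (\<lambda>x. partial_deriv q b x * flat_exp ([:0, 0, 1:] * (P - pderiv P)) (q x))"
      if "b \<in> Basis" for b
      using assms[of "Suc k"] that by (intro Ck_mult Suc) auto
  qed
qed

text \<open>For \<open>c > 0\<close> this is positive exactly where
  \<open>(norm x)\<^sup>2 < r\<close>. It serves twice: as a nonzero test function on balls and,
  with growing \<open>c\<close>, as a cutoff tending to 1.\<close>

lemma Ck_bump: "Ck k (\<lambda>x. flat_exp 1 (c * (r - (norm x)\<^sup>2)))"
proof -
  have "Ck j (\<lambda>x::'a. c * r + (- c) * (norm x)\<^sup>2)" for j
    by (intro Ck_add Ck_const Ck_mult Ck_norm_square)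
  then show ?thesis
    using Ck_flat_exp[of "\<lambda>x::'a. c * r + (- c) * (norm x)\<^sup>2"] by (simp add: algebra_simps)
qed

section \<open>Test functions and Sobolev functions\<close>

lemma abs_powr_has_derivative:
  fixes q s :: real
  assumes "q > 1"
  shows "((\<lambda>s. \<bar>s\<bar> powr q) has_real_derivative q * \<bar>s\<bar> powr (q - 1) * sgn s) (at s)"
proof (cases "s = 0")
  case False
  have "(abs has_real_derivative sgn s) (at s)"
  proof -
    have "\<forall>\<^sub>F y in nhds s. y \<in> (if s > 0 then {0<..} else {..<0})"
      using False by (intro eventually_nhds_in_open) auto
    then have "\<forall>\<^sub>F y in nhds s. \<bar>y\<bar> = sgn s * y"
      using False by (auto elim!: eventually_mono split: if_splits)
    then show ?thesis
      by (subst DERIV_cong_ev[OF refl _ refl]) (auto intro!: derivative_eq_intros)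
  qed
  from has_real_derivative_powr[THEN DERIV_chain2, OF _ this] False show ?thesis by simp
next
  case True
  \<comment> \<open>At 0 the difference quotient has absolute value
    \<open>\<bar>h\<bar> powr (q - 1)\<close>, which tends to 0 because
    \<open>q > 1\<close>.\<close>
  have "((\<lambda>h. \<bar>\<bar>h\<bar> powr q / h\<bar>) \<longlongrightarrow> 0) (at 0)"
  proof (rule Lim_transform_eventually)
    have "((\<lambda>h::real. \<bar>h\<bar> powr (q - 1)) \<longlongrightarrow> \<bar>0\<bar> powr (q - 1)) (at 0)"
      using assms by (intro tendsto_powr2 tendsto_intros) auto
    then show "((\<lambda>h::real. \<bar>h\<bar> powr (q - 1)) \<longlongrightarrow> 0) (at 0)" by simp
    show "\<forall>\<^sub>F h::real in at 0. \<bar>h\<bar> powr (q - 1) = \<bar>\<bar>h\<bar> powr q / h\<bar>"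
      by (auto simp: eventually_at_filter powr_diff abs_divide)
  qed
  from tendsto_rabs_zero_cancel[OF this] show ?thesis
    using True by (simp add: has_field_derivative_iff)
qed

text \<open>If \<open>a\<close> or \<open>b\<close> is 0, the claim is a multiple of
  \<open>s powr q \<le> s\<close> for s in [0, 1]; if both are positive, it is convexity of the
  power.\<close>

lemma powr_convex_nonneg:
  fixes a b q t :: real
  assumes "q \<ge> 1" "a \<ge> 0" "b \<ge> 0" "0 \<le> t" "t \<le> 1"
  shows "((1 - t) * a + t * b) powr q \<le> (1 - t) * a powr q + t * b powr q"
proof -
  have le: "(s * c) powr q \<le> s * c powr q" if "0 \<le> s" "s \<le> 1" "0 \<le> c" for s c :: real
  proof -
    have "s powr q \<le> s powr 1" 
      using that assms by (intro powr_mono') auto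
    then show ?thesis
      using that by (auto simp: powr_mult intro!: mult_right_mono)
  qed
  consider "a = 0" | "b = 0" | "a > 0" "b > 0" using assms by linarith
  then show ?thesis
  proof cases
    case 1
    then show ?thesis using le[of t b] assms by simp
  next
    case 2
    then show ?thesis using le[of "1 - t" a] assms by simp
  next
    case 3
    then show ?thesis using convex_onD[OF powr_convex[of q], of t a b] assms by simp
  qed
qed

text \<open>Convexity at the points a / (1 - t) and b / t with weights 1 - t and t. This takes the
  place of Minkowski's inequality: as \<open>t\<close> tends to 0 the factor of
  \<open>a powr p\<close> tends to 1, and the large factor of \<open>b powr p\<close> is harmless
  when \<open>b\<close> is an approximation error.\<close>

lemma powr_add_le:
  fixes a b p t :: real
  assumes "p \<ge> 1" "a \<ge> 0" "b \<ge> 0" "0 < t" "t < 1"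
  shows "(a + b) powr p \<le> (1 - t) powr (1 - p) * a powr p + t powr (1 - p) * b powr p"
proof -
  have s: "s * (c / s) powr p = s powr (1 - p) * c powr p" if "s > 0" for s c :: real
    using that by (simp add: powr_divide powr_diff)
  have "(a + b) powr p = ((1 - t) * (a / (1 - t)) + t * (b / t)) powr p"
    using assms by simp
  also have "\<dots> \<le> (1 - t) * (a / (1 - t)) powr p + t * (b / t) powr p"
    using assms by (intro powr_convex_nonneg) auto
  finally show ?thesis using assms by (simp add: s)
qed

section \<open>Integrals of compactly supported functions\<close>

lemma
  fixes f :: "'a::euclidean_space \<Rightarrow> 'b::euclidean_space"
  assumes "open \<Omega>" "f \<in> borel_measurable borel" "\<And>x. x \<notin> \<Omega> \<Longrightarrow> f x = 0"
  shows integral_lebesgue_on_eq: "integral\<^sup>L (lebesgue_on \<Omega>) f = integral\<^sup>L lborel f"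
    and integrable_lebesgue_on_iff: "integrable (lebesgue_on \<Omega>) f \<longleftrightarrow> integrable lborel f"
proof -
  have "\<Omega> \<in> sets lebesgue" using assms by auto
  moreover have "(\<lambda>x. if x \<in> \<Omega> then f x else 0) = f" using assms by auto
  ultimately show "integral\<^sup>L (lebesgue_on \<Omega>) f = integral\<^sup>L lborel f"
    "integrable (lebesgue_on \<Omega>) f \<longleftrightarrow> integrable lborel f"
    using Lebesgue_Measure.integral_restrict_UNIV[of \<Omega> f]
      Lebesgue_Measure.integrable_restrict_UNIV[of \<Omega> f] assms
    by (simp_all add: integral_completion integrable_completion)
qed

lemma integrable_compact_support:
  fixes f :: "'a::euclidean_space \<Rightarrow> 'b::euclidean_space"
  assumes "continuous_on UNIV f" "compact K" "\<And>x. x \<notin> K \<Longrightarrow> f x = 0"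
  shows "integrable lborel f"
proof -
  have "(\<lambda>x. indicator K x *\<^sub>R f x) = f" using assms(3) by (auto simp: indicator_def)
  then show ?thesis
    using borel_integrable_compact[OF assms(2) continuous_on_subset[OF assms(1)]] by simp
qed

text \<open>Integrating a difference quotient gives \<open>0\<close> by translation invariance; the Lipschitz bound
  allows the limit to be taken under the integral.\<close>

lemma integral_directional_derivative_zero:
  fixes g D :: "'a::euclidean_space \<Rightarrow> real" and b :: 'a
  assumes g: "continuous_on UNIV g" and K: "compact K" "\<And>x. x \<notin> K \<Longrightarrow> g x = 0"
    and D: "\<And>x. ((\<lambda>t. g (x + t *\<^sub>R b)) has_real_derivative D x) (at 0)"
    and M: "\<And>x. \<bar>D x\<bar> \<le> M"
  shows "integrable lborel D" "integral\<^sup>L lborel D = 0"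
proof -
  have [measurable]: "g \<in> borel_measurable borel"
    using g by (rule borel_measurable_continuous_onI)
  have int_g: "integrable lborel g" by (rule integrable_compact_support[OF g K])
  have distr: "distr lborel borel (\<lambda>x. x + c) = lborel" for c :: 'a
    using lborel_distr_plus[of c] by (simp add: add.commute[of _ c])
  have int_shift: "integrable lborel (\<lambda>x. g (x + c))" 
    and integral_shift: "integral\<^sup>L lborel (\<lambda>x. g (x + c)) = integral\<^sup>L lborel g" for c
    using integrable_distr_eq[of "\<lambda>x. x + c" lborel borel g] integral_distr[of "\<lambda>x. x + c" lborel borel g]
    by (simp_all add: distr int_g)
  define e where "e n = inverse (real (Suc n))" for n
  define s where "s n x = (g (x + e n *\<^sub>R b) - g x) / e n" for n x
  have e: "0 < e n" "e n \<le> 1" for n by (auto simp: e_def field_simps)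
  have e0: "e \<longlonglongrightarrow> 0" unfolding e_def by (rule LIMSEQ_inverse_real_of_nat)
  obtain r where r: "\<And>x. x \<in> K \<Longrightarrow> norm x \<le> r"
    using compact_imp_bounded[OF K(1)] by (auto simp: bounded_iff)
  \<comment> \<open>One majorant for all quotients: the shifts have length at most
    \<open>norm b\<close>, so every \<open>s n\<close> vanishes outside the enlarged ball, and
    inside it the mean value theorem gives the bound \<open>M\<close>.\<close>
  define w where "w x = M * indicator (cball 0 (r + norm b)) x" for x :: 'a
  \<comment> \<open>The hypothesis concerns \<open>t = 0\<close> only, but at every base point;
    moving the base point gives the derivative along the whole line.\<close>
  have der: "((\<lambda>t. g (x + t *\<^sub>R b)) has_real_derivative D (x + t *\<^sub>R b)) (at t)" for x t
    using D[of "x + t *\<^sub>R b"] DERIV_shift[of "\<lambda>t. g (x + t *\<^sub>R b)" _ 0 t]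
    by (simp add: algebra_simps)
  have M0: "M \<ge> 0" using M[of 0] by linarith
  have bound: "\<bar>s n x\<bar> \<le> w x" for n x
  proof (cases "norm x \<le> r + norm b")
    case True
    obtain z where "g (x + e n *\<^sub>R b) - g (x + 0 *\<^sub>R b) = (e n - 0) * D (x + z *\<^sub>R b)"
      using MVT2[of 0 "e n" "\<lambda>t. g (x + t *\<^sub>R b)" "\<lambda>t. D (x + t *\<^sub>R b)"] der e by blast
    then have "s n x = D (x + z *\<^sub>R b)" using e(1)[of n] by (simp add: s_def)
    then show ?thesis using M True by (simp add: w_def dist_norm)
  next
    case False
    have "norm (e n *\<^sub>R b) \<le> norm b" using e[of n] by (simp add: mult_left_le_one_le)
    moreover have "norm x \<le> norm (x + e n *\<^sub>R b) + norm (e n *\<^sub>R b)"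
      using norm_triangle_ineq4[of "x + e n *\<^sub>R b" "e n *\<^sub>R b"] by simp
    ultimately have "x + e n *\<^sub>R b \<notin> K" "x \<notin> K" using False r[of x] r[of "x + e n *\<^sub>R b"] 
      by (auto simp: not_le intro: add_increasing2) (smt (verit) norm_ge_zero)+
    then show ?thesis using K(2) M0 by (simp add: s_def w_def)
  qed
  have lim: "(\<lambda>n. s n x) \<longlonglongrightarrow> D x" for x
  proof -
    have "filterlim e (at 0) sequentially"
      using e0 e(1) by (auto simp: filterlim_at less_imp_neq[symmetric] intro!: always_eventually)
    then show ?thesis
      using filterlim_compose[OF D[of x, unfolded has_field_derivative_iff], of e sequentially]
      by (simp add: s_def)
  qed
  have s_meas [measurable]: "s n \<in> borel_measurable lborel" for n
    unfolding s_def[abs_def] by measurable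
  have D_meas: "D \<in> borel_measurable lborel"
    by (rule borel_measurable_LIMSEQ_real[OF lim s_meas])
  have w: "integrable lborel w"
    unfolding w_def[abs_def] by (intro integrable_mult_right integrable_real_indicator)
      (use emeasure_bounded_finite[OF bounded_cball] in \<open>auto simp: top_unique\<close>)
  show "integrable lborel D"
    by (rule integrable_dominated_convergence[where s = s, OF D_meas s_meas w]) (use lim bound in auto)
  have "(\<lambda>n. integral\<^sup>L lborel (s n)) \<longlonglongrightarrow> integral\<^sup>L lborel D"
    by (rule integral_dominated_convergence[where s = s, OF D_meas s_meas w]) (use lim bound in auto)
  moreover have "integral\<^sup>L lborel (s n) = 0" for n
    unfolding s_def[abs_def] by (simp add: int_shift int_g integral_shift)
  ultimately show "integral\<^sup>L lborel D = 0" by (simp add: LIMSEQ_const_iff)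
qed

section \<open>Gradients and integrability of test functions\<close>

lemma grad_inner_Basis: "b \<in> Basis \<Longrightarrow> grad f x \<bullet> b = partial_deriv f b x"
  by (simp add: grad_def inner_sum_left inner_Basis if_distrib sum.If_cases cong: if_cong)

lemma has_derivative_grad:
  assumes "Ck (Suc k) f"
  shows "(f has_derivative (\<lambda>h. grad f x \<bullet> h)) (at x)"
proof -
  note d = Ck_Suc_has_derivative[OF assms, of x]
  interpret linear "\<lambda>h. partial_deriv f h x" using d has_derivative_linear by blast
  have "partial_deriv f h x = grad f x \<bullet> h" for h
  proof -
    have "partial_deriv f h x = partial_deriv f (\<Sum>b\<in>Basis. (h \<bullet> b) *\<^sub>R b) x"
      by (simp add: euclidean_representation)
    also have "\<dots> = (\<Sum>b\<in>Basis. (h \<bullet> b) * partial_deriv f b x)"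
      by (simp add: sum scale)
    also have "\<dots> = grad f x \<bullet> h"
      by (simp add: grad_def inner_sum_left inner_commute[of h] mult.commute)
    finally show ?thesis .
  qed
  then show ?thesis using d by simp
qed

lemma continuous_on_grad:
  assumes "Ck (Suc k) f"
  shows "continuous_on UNIV (grad f)"
proof -
  have "continuous_on UNIV (partial_deriv f b)" if "b \<in> Basis" for b
    using assms that Ck_continuous[of k] by auto
  then show ?thesis
    unfolding grad_def[abs_def] by (intro continuous_intros) auto
qed

lemma test_function_Ck: "test_function \<Omega> \<phi> \<Longrightarrow> Ck k \<phi>"
  by (simp add: test_function_def)

text \<open>\<open>\<phi>\<close> vanishes on the open complement of its closed support, so its
  derivative vanishes there as well; one compact \<open>K\<close> then serves both
  functions.\<close>

lemma test_function_support:
  fixes \<Omega> :: "'a::euclidean_space set"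
  assumes "test_function \<Omega> \<phi>"
  shows "\<exists>K. compact K \<and> K \<subseteq> \<Omega> \<and> (\<forall>x. x \<notin> K \<longrightarrow> \<phi> x = 0 \<and> grad \<phi> x = 0)"
proof (intro exI conjI allI impI)
  let ?K = "closure {x. \<phi> x \<noteq> 0}"
  show "compact ?K" "?K \<subseteq> \<Omega>" using assms by (auto simp: test_function_def)
  show out: "\<phi> x = 0" if "x \<notin> ?K" for x
    using that closure_subset[of "{x. \<phi> x \<noteq> 0}"] by auto
  show "grad \<phi> x = 0" if "x \<notin> ?K" for x
  proof -
    have "\<forall>\<^sub>F y in nhds x. y \<in> - ?K"
      using that by (intro eventually_nhds_in_open) auto
    then have ev: "\<forall>\<^sub>F y in nhds x. \<phi> y = 0"
      by (rule eventually_mono) (use out in blast)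
    then have "(\<phi> has_derivative (\<lambda>_. 0)) (at x)"
      using eventually_nhds_x_imp_x[OF ev]
      by (intro has_derivative_transform_eventually[of "\<lambda>_. 0" "\<lambda>_. 0" x UNIV \<phi>])
        (auto simp: eventually_at_filter elim: eventually_mono)
    then have "partial_deriv \<phi> b x = 0" for b by (simp add: partial_deriv_eq)
    then show ?thesis by (simp add: grad_def)
  qed
qed

lemma test_function_bounded:
  fixes \<Omega> :: "'a::euclidean_space set"
  assumes "test_function \<Omega> \<phi>"
  shows "\<exists>B. \<forall>x. \<bar>\<phi> x\<bar> \<le> B \<and> norm (grad \<phi> x) \<le> B"
proof -
  obtain K where K: "compact K" "K \<subseteq> \<Omega>" "\<And>x. x \<notin> K \<Longrightarrow> \<phi> x = 0" "\<And>x. x \<notin> K \<Longrightarrow> grad \<phi> x = 0"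
    using test_function_support[OF assms] by blast
  have bnd: "\<exists>B. \<forall>x. norm (f x) \<le> B" if "continuous_on UNIV f" "\<And>x. x \<notin> K \<Longrightarrow> f x = 0"
    for f :: "'a \<Rightarrow> 'b::euclidean_space"
  proof -
    have "bounded (f ` K)"
      using K(1) that(1) by (meson compact_continuous_image compact_imp_bounded continuous_on_subset subset_UNIV)
    then obtain B where "\<And>x. x \<in> K \<Longrightarrow> norm (f x) \<le> B" by (auto simp: bounded_iff)
    then have "norm (f x) \<le> max B 0" for x using that(2)[of x] by (cases "x \<in> K") (auto intro: max.coboundedI1)
    then show ?thesis by blast
  qed
  have "continuous_on UNIV \<phi>" "continuous_on UNIV (grad \<phi>)"
    using Ck_continuous test_function_Ck[OF assms] continuous_on_grad by blast+
  then obtain B1 B2 where "\<And>x. norm (\<phi> x) \<le> B1" "\<And>x. norm (grad \<phi> x) \<le> B2"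
    using bnd[of \<phi>] bnd[of "grad \<phi>"] K by metis
  then show ?thesis by (intro exI[of _ "max B1 B2"]) (simp add: le_max_iff_disj)
qed

lemma
  fixes f :: "'a::euclidean_space \<Rightarrow> 'b::euclidean_space"
  assumes "open \<Omega>" "continuous_on UNIV f" "compact K" "K \<subseteq> \<Omega>" "\<And>x. x \<notin> K \<Longrightarrow> f x = 0" "p > 0"
  shows Lp_compact_support: "Lp p \<Omega> f"
    and integral_lebesgue_on_powr: "(LINT x|lebesgue_on \<Omega>. norm (f x) powr p) = (LINT x|lborel. norm (f x) powr p)"
    and integrable_powr: "integrable lborel (\<lambda>x. norm (f x) powr p)"
proof -
  have [measurable]: "f \<in> borel_measurable borel"
    using assms(2) by (rule borel_measurable_continuous_onI)
  have c: "continuous_on UNIV (\<lambda>x. norm (f x) powr p)"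
    using assms by (intro continuous_on_powr' continuous_intros) auto
  show i: "integrable lborel (\<lambda>x. norm (f x) powr p)"
    by (rule integrable_compact_support[OF c assms(3)]) (use assms in auto)
  show "(LINT x|lebesgue_on \<Omega>. norm (f x) powr p) = (LINT x|lborel. norm (f x) powr p)"
    by (rule integral_lebesgue_on_eq) (use assms in auto)
  have "f \<in> borel_measurable lebesgue"
    by (simp add: measurable_completion)
  then show "Lp p \<Omega> f"
    unfolding Lp_def using i assms(1,4,5)
    by (subst integrable_lebesgue_on_iff) (auto intro: measurable_restrict_space1)
qed

lemma
  fixes \<phi> :: "'a::euclidean_space \<Rightarrow> real"
  assumes "open \<Omega>" "test_function \<Omega> \<phi>" "p > 0"
  shows Lp_test_function: "Lp p \<Omega> \<phi>" and Lp_grad_test_function: "Lp p \<Omega> (grad \<phi>)"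
    and integral_test_function: "(LINT x|lebesgue_on \<Omega>. \<bar>\<phi> x\<bar> powr p) = (LINT x|lborel. \<bar>\<phi> x\<bar> powr p)"
    and integral_grad_test_function:
      "(LINT x|lebesgue_on \<Omega>. norm (grad \<phi> x) powr p) = (LINT x|lborel. norm (grad \<phi> x) powr p)"
    and integrable_test_function: "integrable lborel (\<lambda>x. \<bar>\<phi> x\<bar> powr p)"
    and integrable_grad_test_function: "integrable lborel (\<lambda>x. norm (grad \<phi> x) powr p)"
proof -
  obtain K where K: "compact K" "K \<subseteq> \<Omega>" "\<And>x. x \<notin> K \<Longrightarrow> \<phi> x = 0" "\<And>x. x \<notin> K \<Longrightarrow> grad \<phi> x = 0"
    using test_function_support[OF assms(2)] by blast
  have c: "continuous_on UNIV \<phi>" "continuous_on UNIV (grad \<phi>)"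
    using Ck_continuous test_function_Ck[OF assms(2)] continuous_on_grad by blast+
  note 1 = assms(1) c(1) K(1,2,3) assms(3) and 2 = assms(1) c(2) K(1,2,4) assms(3)
  show "Lp p \<Omega> \<phi>" by (rule Lp_compact_support[OF 1])
  show "Lp p \<Omega> (grad \<phi>)" by (rule Lp_compact_support[OF 2])
  show "(LINT x|lebesgue_on \<Omega>. \<bar>\<phi> x\<bar> powr p) = (LINT x|lborel. \<bar>\<phi> x\<bar> powr p)"
    using integral_lebesgue_on_powr[OF 1] by simp
  show "(LINT x|lebesgue_on \<Omega>. norm (grad \<phi> x) powr p) = (LINT x|lborel. norm (grad \<phi> x) powr p)"
    by (rule integral_lebesgue_on_powr[OF 2])
  show "integrable lborel (\<lambda>x. \<bar>\<phi> x\<bar> powr p)"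
    using integrable_powr[OF 1] by simp
  show "integrable lborel (\<lambda>x. norm (grad \<phi> x) powr p)"
    by (rule integrable_powr[OF 2])
qed

lemma has_directional_derivative:
  assumes "(f has_derivative f') (at x)"
  shows "((\<lambda>t. f (x + t *\<^sub>R b)) has_real_derivative f' b) (at 0)"
proof -
  have "((\<lambda>t. x + t *\<^sub>R b) has_derivative (\<lambda>t. t *\<^sub>R b)) (at 0)"
    by (auto intro!: derivative_eq_intros)
  from has_derivative_compose[OF this, of f f'] assms
  have "((\<lambda>t. f (x + t *\<^sub>R b)) has_derivative (\<lambda>t. f' (t *\<^sub>R b))) (at 0)" by simp
  moreover have "f' (t *\<^sub>R b) = t * f' b" for t
    using linear_scale[OF has_derivative_linear[OF assms]] by simp
  ultimately show ?thesis by (simp add: has_field_derivative_def mult_commute_abs)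
qed

text \<open>Integration by parts without boundary terms: the product of the two test functions has
  compact support, so its derivative along \<open>b\<close> integrates to 0.\<close>

lemma weak_gradient_test_function:
  fixes \<phi> :: "'a::euclidean_space \<Rightarrow> real"
  assumes "open \<Omega>" "test_function \<Omega> \<phi>"
  shows "weak_gradient \<Omega> \<phi> (grad \<phi>)"
  unfolding weak_gradient_def
proof (intro allI impI)
  fix f :: "'a \<Rightarrow> real" and b :: 'a
  assume f: "test_function \<Omega> f" and b: "b \<in> Basis"
  obtain K where K: "compact K" "K \<subseteq> \<Omega>" "\<And>x. x \<notin> K \<Longrightarrow> \<phi> x = 0" "\<And>x. x \<notin> K \<Longrightarrow> grad \<phi> x = 0"
    using test_function_support[OF assms(2)] by blast
  have c: "continuous_on UNIV \<phi>" "continuous_on UNIV (grad \<phi>)" "continuous_on UNIV f" "continuous_on UNIV (grad f)"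
    using Ck_continuous test_function_Ck[OF assms(2)] test_function_Ck[OF f] continuous_on_grad by blast+
  define D1 where "D1 x = \<phi> x * (grad f x \<bullet> b)" for x
  define D2 where "D2 x = (grad \<phi> x \<bullet> b) * f x" for x
  have c1: "continuous_on UNIV D1" and c2: "continuous_on UNIV D2"
    unfolding D1_def[abs_def] D2_def[abs_def] using c by (auto intro!: continuous_intros)
  have m: "D1 \<in> borel_measurable borel" "D2 \<in> borel_measurable borel"
    using c1 c2 by (auto intro: borel_measurable_continuous_onI)
  have i: "integrable lborel D1" "integrable lborel D2"
    by (rule integrable_compact_support[OF c1 K(1)] integrable_compact_support[OF c2 K(1)],
      simp add: D1_def D2_def K)+
  obtain B where B: "\<And>x. \<bar>\<phi> x\<bar> \<le> B" "\<And>x. norm (grad \<phi> x) \<le> B"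
    using test_function_bounded[OF assms(2)] by blast
  obtain B' where B': "\<And>x. \<bar>f x\<bar> \<le> B'" "\<And>x. norm (grad f x) \<le> B'"
    using test_function_bounded[OF f] by blast
  have B0: "0 \<le> B" using B(1)[of 0] by linarith
  have "integral\<^sup>L lborel (\<lambda>x. D1 x + D2 x) = 0"
  proof (rule integral_directional_derivative_zero(2)[where g = "\<lambda>x. \<phi> x * f x" and K = K and b = b])
    show "continuous_on UNIV (\<lambda>x. \<phi> x * f x)" using c by (auto intro!: continuous_intros)
    show "((\<lambda>t. \<phi> (x + t *\<^sub>R b) * f (x + t *\<^sub>R b)) has_real_derivative D1 x + D2 x) (at 0)" for x
      using DERIV_mult[OF has_directional_derivative[OF has_derivative_grad[OF test_function_Ck[OF assms(2)]], of x b]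
        has_directional_derivative[OF has_derivative_grad[OF test_function_Ck[OF f]], of x b]]
      by (simp add: D1_def D2_def algebra_simps)
    show "\<bar>D1 x + D2 x\<bar> \<le> B * B' + B * B'" for x
    proof -
      have n: "\<bar>v \<bullet> b\<bar> \<le> norm v" for v :: 'a using Basis_le_norm[OF b] by simp
      have "\<bar>D1 x\<bar> \<le> B * B'" "\<bar>D2 x\<bar> \<le> B * B'"
        unfolding D1_def D2_def abs_mult
        using B B' n[of "grad f x"] n[of "grad \<phi> x"] B0 order_trans by (blast intro: mult_mono abs_ge_zero)+
      then show ?thesis by linarith
    qed
  qed (use K in auto)
  then have "integral\<^sup>L lborel D1 = - integral\<^sup>L lborel D2" using i by simp
  moreover have "integral\<^sup>L (lebesgue_on \<Omega>) D1 = integral\<^sup>L lborel D1"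
    "integral\<^sup>L (lebesgue_on \<Omega>) D2 = integral\<^sup>L lborel D2"
  proof -
    have "x \<notin> K" if "x \<notin> \<Omega>" for x using K(2) that by blast
    then show "integral\<^sup>L (lebesgue_on \<Omega>) D1 = integral\<^sup>L lborel D1"
      "integral\<^sup>L (lebesgue_on \<Omega>) D2 = integral\<^sup>L lborel D2"
      using K(3,4) m assms(1) by (simp_all add: integral_lebesgue_on_eq D1_def D2_def)
  qed
  ultimately show "(LINT x|lebesgue_on \<Omega>. \<phi> x * partial_deriv f b x) =
      - (LINT x|lebesgue_on \<Omega>. (grad \<phi> x \<bullet> b) * f x)"
    using b by (simp add: D1_def[abs_def] D2_def[abs_def] grad_inner_Basis)
qed

lemma test_function_in_W01p:
  assumes "open \<Omega>" "test_function \<Omega> \<phi>" "p > 0"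
  shows "(\<phi>, grad \<phi>) \<in> W01p p \<Omega>"
  unfolding W01p_def W1p_def
  using assms Lp_test_function Lp_grad_test_function weak_gradient_test_function
  by (auto intro!: exI[of _ "\<lambda>_. \<phi>"])

section \<open>Passage from test functions to Sobolev functions and the eigenvalue\<close>

lemma Lp_integral_le:
  fixes u v :: "'a::euclidean_space \<Rightarrow> 'b::euclidean_space"
  assumes "Lp p \<Omega> u" "Lp p \<Omega> v" "p \<ge> 1" and t: "0 < t" "t < 1"
  shows "(LINT x|lebesgue_on \<Omega>. norm (u x) powr p) \<le>
      (1 - t) powr (1 - p) * (LINT x|lebesgue_on \<Omega>. norm (v x) powr p) +
      t powr (1 - p) * (LINT x|lebesgue_on \<Omega>. norm (u x - v x) powr p)"
proof -
  have u [measurable]: "u \<in> borel_measurable (lebesgue_on \<Omega>)" 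
    and v [measurable]: "v \<in> borel_measurable (lebesgue_on \<Omega>)"
    and iu: "integrable (lebesgue_on \<Omega>) (\<lambda>x. norm (u x) powr p)"
    and iv: "integrable (lebesgue_on \<Omega>) (\<lambda>x. norm (v x) powr p)"
    using assms by (auto simp: Lp_def)
  have tri: "norm w powr p \<le> (1 - t) powr (1 - p) * norm y powr p + t powr (1 - p) * norm z powr p"
    if "0 < t" "t < 1" "norm w \<le> norm y + norm z" for t and w y z :: 'b
    using powr_mono2[of p "norm w" "norm y + norm z"] powr_add_le[of p "norm y" "norm z" t] that assms(3)
    by simp
  have i: "integrable (lebesgue_on \<Omega>) (\<lambda>x. norm (u x - v x) powr p)"
  proof (rule Bochner_Integration.integrable_bound)
    show "integrable (lebesgue_on \<Omega>) (\<lambda>x. (1 - 1/2) powr (1 - p) * norm (u x) powr p +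
        (1/2) powr (1 - p) * norm (v x) powr p)"
      using iu iv by auto
    show "(\<lambda>x. norm (u x - v x) powr p) \<in> borel_measurable (lebesgue_on \<Omega>)"
      by measurable
    show "AE x in lebesgue_on \<Omega>. norm (norm (u x - v x) powr p) \<le>
       norm ((1 - 1/2) powr (1 - p) * norm (u x) powr p + (1/2) powr (1 - p) * norm (v x) powr p)"
      using tri[of "1/2", OF _ _ norm_triangle_ineq4] by (auto intro!: always_eventually)
  qed
  show "(LINT x|lebesgue_on \<Omega>. norm (u x) powr p) \<le>
      (1 - t) powr (1 - p) * (LINT x|lebesgue_on \<Omega>. norm (v x) powr p) +
      t powr (1 - p) * (LINT x|lebesgue_on \<Omega>. norm (u x - v x) powr p)"
  proof -
    have "(LINT x|lebesgue_on \<Omega>. norm (u x) powr p) \<le> (LINT x|lebesgue_on \<Omega>.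
       (1 - t) powr (1 - p) * norm (v x) powr p + t powr (1 - p) * norm (u x - v x) powr p)"
    proof (rule integral_mono)
      show "norm (u x) powr p \<le> (1 - t) powr (1 - p) * norm (v x) powr p + t powr (1 - p) * norm (u x - v x) powr p" for x
        by (rule tri[OF t]) (use norm_triangle_sub in blast)
    qed (use iu iv i in auto)
    then show ?thesis using iv i by simp
  qed
qed

text \<open>\<open>Lp_integral_le\<close> is used once for \<open>u\<close> against the approximant
  and once for the gradient of the approximant against \<open>g\<close>, so the factor
  \<open>(1 - t) powr (1 - p)\<close> appears twice. For fixed \<open>t\<close> the errors vanish
  along the sequence; only afterwards does \<open>t\<close> tend to 0.\<close>

lemma W01p_poincare:
  fixes \<Omega> :: "'a::euclidean_space set"
  assumes "open \<Omega>" "p > 1" "\<mu> \<ge> 0"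
    and test: "\<And>\<phi>. test_function \<Omega> \<phi> \<Longrightarrow>
      \<mu> * (LINT x|lborel. \<bar>\<phi> x\<bar> powr p) \<le> (LINT x|lborel. norm (grad \<phi> x) powr p)"
    and ug: "(u, g) \<in> W01p p \<Omega>"
  shows "\<mu> * (LINT x|lebesgue_on \<Omega>. \<bar>u x\<bar> powr p) \<le> (LINT x|lebesgue_on \<Omega>. norm (g x) powr p)"
proof -
  define U where "U = (LINT x|lebesgue_on \<Omega>. \<bar>u x\<bar> powr p)"
  define G where "G = (LINT x|lebesgue_on \<Omega>. norm (g x) powr p)"
  obtain \<phi> where \<phi>: "\<And>k. test_function \<Omega> (\<phi> k)"
    and lim: "(\<lambda>k. (LINT x|lebesgue_on \<Omega>. \<bar>u x - \<phi> k x\<bar> powr p) +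
          (LINT x|lebesgue_on \<Omega>. norm (g x - grad (\<phi> k) x) powr p)) \<longlonglongrightarrow> 0"
    and Lp: "Lp p \<Omega> u" "Lp p \<Omega> g"
    using ug by (auto simp: W01p_def W1p_def)
  define e1 where "e1 k = (LINT x|lebesgue_on \<Omega>. \<bar>u x - \<phi> k x\<bar> powr p)" for k
  define e2 where "e2 k = (LINT x|lebesgue_on \<Omega>. norm (g x - grad (\<phi> k) x) powr p)" for k
  have nn: "e1 k \<ge> 0" "e2 k \<ge> 0" for k unfolding e1_def e2_def by auto
  have e1: "e1 \<longlonglongrightarrow> 0" and e2: "e2 \<longlonglongrightarrow> 0"
    using tendsto_sandwich[of "\<lambda>_. 0" e1 sequentially "\<lambda>k. e1 k + e2 k" 0]
      tendsto_sandwich[of "\<lambda>_. 0" e2 sequentially "\<lambda>k. e1 k + e2 k" 0] nn lim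
    by (auto simp: e1_def[symmetric] e2_def[symmetric])
  have step: "\<mu> * U \<le> (1 - t) powr (1 - p) * ((1 - t) powr (1 - p) * G)" if t: "0 < t" "t < 1" for t
  proof -
    let ?c = "(1 - t) powr (1 - p)" and ?d = "t powr (1 - p)"
    have "\<mu> * U \<le> ?c * (?c * G + ?d * e2 k) + \<mu> * (?d * e1 k)" for k
    proof -
      let ?P = "LINT x|lborel. \<bar>\<phi> k x\<bar> powr p" and ?Q = "LINT x|lborel. norm (grad (\<phi> k) x) powr p"
      have L: "Lp p \<Omega> (\<phi> k)" "Lp p \<Omega> (grad (\<phi> k))"
        using Lp_test_function[OF assms(1) \<phi>] Lp_grad_test_function[OF assms(1) \<phi>] assms(2) by simp_all
      have "U \<le> ?c * ?P + ?d * e1 k"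
        using Lp_integral_le[OF Lp(1) L(1) _ t] integral_test_function[OF assms(1) \<phi>, of p] assms(2)
        by (simp add: U_def e1_def)
      then have "\<mu> * U \<le> \<mu> * (?c * ?P + ?d * e1 k)"
        using assms(3) by (rule mult_left_mono)
      also have "\<dots> = ?c * (\<mu> * ?P) + \<mu> * (?d * e1 k)" by (simp add: algebra_simps)
      also have "\<dots> \<le> ?c * ?Q + \<mu> * (?d * e1 k)"
        using test[OF \<phi>] by (intro add_right_mono mult_left_mono) auto
      also have "\<dots> \<le> ?c * (?c * G + ?d * e2 k) + \<mu> * (?d * e1 k)"
        using Lp_integral_le[OF L(2) Lp(2) _ t] integral_grad_test_function[OF assms(1) \<phi>, of p] assms(2)
        by (intro add_right_mono mult_left_mono) (auto simp: G_def e2_def norm_minus_commute)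
      finally show ?thesis .
    qed
    moreover have "(\<lambda>k. ?c * (?c * G + ?d * e2 k) + \<mu> * (?d * e1 k)) \<longlonglongrightarrow> ?c * (?c * G + ?d * 0) + \<mu> * (?d * 0)"
      by (intro tendsto_intros e1 e2)
    ultimately show ?thesis using LIMSEQ_le_const by fastforce
  qed
  have "((\<lambda>t. (1 - t) powr (1 - p) * ((1 - t) powr (1 - p) * G)) \<longlongrightarrow> (1 - 0) powr (1 - p) * ((1 - 0) powr (1 - p) * G)) (at_right 0)"
    by (intro tendsto_intros) auto
  then have "\<mu> * U \<le> G"
  proof (intro tendsto_lowerbound)
    show "\<forall>\<^sub>F t in at_right 0. \<mu> * U \<le> (1 - t) powr (1 - p) * ((1 - t) powr (1 - p) * G)"
      using eventually_at_right_less[of 0] eventually_at_right[of 0 1]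
      by (auto simp: eventually_at_right_field intro!: exI[of _ 1] step)
  qed auto
  then show ?thesis by (simp add: U_def G_def)
qed

lemma AE_eq_0_iff_integral_powr:
  assumes "Lp p \<Omega> u"
  shows "(AE x in lebesgue_on \<Omega>. u x = 0) \<longleftrightarrow> (LINT x|lebesgue_on \<Omega>. \<bar>u x\<bar> powr p) = 0"
  using integral_nonneg_eq_0_iff_AE[of "lebesgue_on \<Omega>" "\<lambda>x. \<bar>u x\<bar> powr p"] assms
  by (simp add: Lp_def)

text \<open>\<open>\<psi>\<close> certifies that the set of quotients is nonempty; for an empty set
  a lower bound on all elements says nothing about \<open>Inf\<close>.\<close>

lemma first_eigenvalue_lower_bound:
  fixes \<Omega> :: "'a::euclidean_space set"
  assumes "open \<Omega>" "p > 1" "\<mu> \<ge> 0"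
    and test: "\<And>\<phi>. test_function \<Omega> \<phi> \<Longrightarrow>
      \<mu> * (LINT x|lborel. \<bar>\<phi> x\<bar> powr p) \<le> (LINT x|lborel. norm (grad \<phi> x) powr p)"
    and \<psi>: "test_function \<Omega> \<psi>" "(LINT x|lborel. \<bar>\<psi> x\<bar> powr p) \<noteq> 0"
  shows "\<mu> \<le> first_eigenvalue p \<Omega>"
  unfolding first_eigenvalue_def
proof (rule cInf_greatest)
  have "(\<psi>, grad \<psi>) \<in> W01p p \<Omega>" using test_function_in_W01p[OF assms(1) \<psi>(1)] assms(2) by simp
  moreover have "\<not> (AE x in lebesgue_on \<Omega>. \<psi> x = 0)"
    using AE_eq_0_iff_integral_powr[OF Lp_test_function[OF assms(1) \<psi>(1)], of p] \<psi>(2) assms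
      integral_test_function[OF assms(1) \<psi>(1), of p] by simp
  ultimately show "{(LINT x|lebesgue_on \<Omega>. norm (g x) powr p) / (LINT x|lebesgue_on \<Omega>. \<bar>u x\<bar> powr p) |u g.
     (u, g) \<in> W01p p \<Omega> \<and> \<not> (AE x in lebesgue_on \<Omega>. u x = 0)} \<noteq> {}"
    by auto
next
  fix q assume "q \<in> {(LINT x|lebesgue_on \<Omega>. norm (g x) powr p) / (LINT x|lebesgue_on \<Omega>. \<bar>u x\<bar> powr p) |u g.
     (u, g) \<in> W01p p \<Omega> \<and> \<not> (AE x in lebesgue_on \<Omega>. u x = 0)}"
  then obtain u g where q: "q = (LINT x|lebesgue_on \<Omega>. norm (g x) powr p) / (LINT x|lebesgue_on \<Omega>. \<bar>u x\<bar> powr p)"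
    and ug: "(u, g) \<in> W01p p \<Omega>" and nz: "\<not> (AE x in lebesgue_on \<Omega>. u x = 0)" by auto
  have "Lp p \<Omega> u" using ug by (auto simp: W01p_def W1p_def)
  from AE_eq_0_iff_integral_powr[OF this] nz
  have "(LINT x|lebesgue_on \<Omega>. \<bar>u x\<bar> powr p) > 0"
    by (simp add: less_le)
  then show "\<mu> \<le> q"
    using W01p_poincare[OF assms(1-3) test ug] by (simp add: q pos_le_divide_eq)
qed

lemma first_eigenvalue_upper_bound:
  fixes \<Omega> :: "'a::euclidean_space set"
  assumes "open \<Omega>" "p > 0" "test_function \<Omega> \<phi>" "(LINT x|lborel. \<bar>\<phi> x\<bar> powr p) \<noteq> 0"
  shows "first_eigenvalue p \<Omega> \<le> (LINT x|lborel. norm (grad \<phi> x) powr p) / (LINT x|lborel. \<bar>\<phi> x\<bar> powr p)"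
  unfolding first_eigenvalue_def
proof (rule cInf_lower)
  have "\<not> (AE x in lebesgue_on \<Omega>. \<phi> x = 0)"
    using AE_eq_0_iff_integral_powr[OF Lp_test_function[OF assms(1,3)], of p] assms
      integral_test_function[OF assms(1,3), of p] by simp
  then show "(LINT x|lborel. norm (grad \<phi> x) powr p) / (LINT x|lborel. \<bar>\<phi> x\<bar> powr p) \<in>
    {(LINT x|lebesgue_on \<Omega>. norm (g x) powr p) / (LINT x|lebesgue_on \<Omega>. \<bar>u x\<bar> powr p) |u g.
     (u, g) \<in> W01p p \<Omega> \<and> \<not> (AE x in lebesgue_on \<Omega>. u x = 0)}"
    using test_function_in_W01p[OF assms(1,3,2)] integral_test_function[OF assms(1,3,2)]
      integral_grad_test_function[OF assms(1,3,2)] by (auto intro!: exI[of _ \<phi>] exI[of _ "grad \<phi>"])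
qed (auto intro!: bdd_belowI[of _ 0])

section \<open>Radial vector fields\<close>

text \<open>Young's inequality for \<open>a\<close> and \<open>h * s powr (p - 1)\<close> with
  exponents p and p / (p - 1), multiplied by p. The left side is the cross term of the divergence
  below, with \<open>a\<close> the gradient norm, \<open>s\<close> the size of the test function and
  \<open>h\<close> that of the field.\<close>

lemma young_powr:
  fixes a h s p :: real
  assumes "p > 1" "a \<ge> 0" "h \<ge> 0" "s \<ge> 0"
  shows "p * s powr (p - 1) * h * a \<le> a powr p + (p - 1) * h powr (p / (p - 1)) * s powr p"
proof -
  let ?q = "p / (p - 1)"
  have "a * (h * s powr (p - 1)) \<le> a powr p / p + (h * s powr (p - 1)) powr ?q / ?q"
    using assms by (intro Youngs_inequality) (auto simp: divide_simps)
  also have "(h * s powr (p - 1)) powr ?q = h powr ?q * s powr p"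
    using assms by (simp add: powr_mult powr_powr)
  finally have "p * (a * (h * s powr (p - 1))) \<le> p * (a powr p / p + h powr ?q * s powr p / ?q)"
    using assms by (intro mult_left_mono) auto
  also have "\<dots> = a powr p + (p - 1) * h powr ?q * s powr p"
    using assms by (simp add: field_simps)
  finally show ?thesis by (simp add: mult_ac)
qed

text \<open>These are the diagonal entries of the Jacobian of the field
  \<open>(H (norm x) / norm x) *\<^sub>R x\<close>; off the origin they sum to
  \<open>D + (N - 1) * (H r / r)\<close>. At the origin division by 0 makes the field vanish, and
  the difference quotient is \<open>H \<bar>t\<bar> / \<bar>t\<bar>\<close>, which tends to
  \<open>D\<close> because \<open>H 0 = 0\<close>.\<close>

lemma radial_field_directional_derivative:
  fixes x b :: "'a::euclidean_space" and H :: "real \<Rightarrow> real"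
  assumes b: "b \<in> Basis" and H0: "H 0 = 0"
    and H: "(H has_real_derivative D) (at (norm x))"
  shows "((\<lambda>t. H (norm (x + t *\<^sub>R b)) / norm (x + t *\<^sub>R b) * ((x + t *\<^sub>R b) \<bullet> b)) has_real_derivative
     (if x = 0 then D else H (norm x) / norm x + (D - H (norm x) / norm x) * (x \<bullet> b)\<^sup>2 / (norm x)\<^sup>2)) (at 0)"
proof (cases "x = 0")
  case True
  have 1: "((\<lambda>h. H h / h) \<longlongrightarrow> D) (at 0)"
    using H True H0 by (simp add: has_field_derivative_iff)
  have "filterlim (\<lambda>t::real. \<bar>t\<bar>) (at 0) (at 0)"
    by (auto simp: filterlim_at eventually_at_filter intro!: tendsto_eq_intros)
  from filterlim_compose[OF 1 this] have "((\<lambda>t. H \<bar>t\<bar> / \<bar>t\<bar>) \<longlongrightarrow> D) (at 0)" .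
  then have "((\<lambda>t. (H \<bar>t\<bar> / \<bar>t\<bar> * t) / t) \<longlongrightarrow> D) (at 0)"
    by (rule Lim_transform_eventually) (auto simp: eventually_at_filter)
  then show ?thesis
    using True b by (simp add: has_field_derivative_iff)
next
  case False
  let ?r = "norm x"
  have n: "((\<lambda>t. norm (x + t *\<^sub>R b)) has_real_derivative (x \<bullet> b) / ?r) (at 0)"
    using has_directional_derivative[OF has_derivative_norm[OF False], of b]
    by (simp add: sgn_div_norm inner_commute divide_inverse mult.commute)
  have Hn: "((\<lambda>t. H (norm (x + t *\<^sub>R b))) has_real_derivative D * ((x \<bullet> b) / ?r)) (at 0)"
    using DERIV_chain2[of H D "\<lambda>t. norm (x + t *\<^sub>R b)" 0, OF _ n] H by simp
  have i: "((\<lambda>t. (x + t *\<^sub>R b) \<bullet> b) has_real_derivative 1) (at 0)"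
    using b by (auto intro!: derivative_eq_intros simp: inner_add_left)
  have "((\<lambda>t. H (norm (x + t *\<^sub>R b)) / norm (x + t *\<^sub>R b) * ((x + t *\<^sub>R b) \<bullet> b)) has_real_derivative
     (D * ((x \<bullet> b) / ?r) * ?r - H ?r * ((x \<bullet> b) / ?r)) / (?r * ?r) * (x \<bullet> b) + 1 * (H ?r / ?r)) (at 0)"
    using DERIV_mult[OF DERIV_divide[OF Hn n] i] False by simp
  moreover have "(D * ((x \<bullet> b) / ?r) * ?r - H ?r * ((x \<bullet> b) / ?r)) / (?r * ?r) * (x \<bullet> b) + 1 * (H ?r / ?r)
     = H ?r / ?r + (D - H ?r / ?r) * (x \<bullet> b)\<^sup>2 / ?r\<^sup>2"
    using False by (simp add: field_simps power2_eq_square)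
  ultimately show ?thesis using False by (simp add: add.commute)
qed

text \<open>Barta's method: for the vector field \<open>F = - H (norm x) * x / norm x\<close> the hypothesis says
  \<open>- div F \<ge> \<mu> + (p - 1) * norm F powr (p / (p - 1))\<close>. Integrate \<open>div (\<bar>\<phi>\<bar> powr p * F)\<close> and
  apply Young's inequality.\<close>

lemma radial_barta_inequality:
  fixes \<phi> :: "'a::euclidean_space \<Rightarrow> real" and H H' :: "real \<Rightarrow> real"
  assumes p: "p > 1" and \<phi>: "test_function (ball 0 R) \<phi>" and H0: "H 0 = 0"
    and H: "\<And>r. 0 \<le> r \<Longrightarrow> r < R \<Longrightarrow> (H has_real_derivative H' r) (at r)"
    and H': "continuous_on {0..<R} H'"
    and barrier: "\<And>r. 0 < r \<Longrightarrow> r < R \<Longrightarrow>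
      \<mu> + (p - 1) * \<bar>H r\<bar> powr (p / (p - 1)) \<le> H' r + (real DIM('a) - 1) * (H r / r)"
  shows "\<mu> * (LINT x|lborel. \<bar>\<phi> x\<bar> powr p) \<le> (LINT x|lborel. norm (grad \<phi> x) powr p)"
proof -
  obtain K where K: "compact K" "K \<subseteq> ball 0 R" "\<And>x. x \<notin> K \<Longrightarrow> \<phi> x = 0" "\<And>x. x \<notin> K \<Longrightarrow> grad \<phi> x = 0"
    using test_function_support[OF \<phi>] by blast
  obtain B where B: "\<And>x. \<bar>\<phi> x\<bar> \<le> B" "\<And>x. norm (grad \<phi> x) \<le> B"
    using test_function_bounded[OF \<phi>] by blast
  have B0: "B \<ge> 0" using B(1)[of 0] by linarith
  have c: "continuous_on UNIV \<phi>" "continuous_on UNIV (grad \<phi>)"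
    using Ck_continuous test_function_Ck[OF \<phi>] continuous_on_grad by blast+
  \<comment> \<open>\<open>H'\<close> may blow up at \<open>R\<close>, but the support of
    \<open>\<phi>\<close> stays in a smaller closed ball, where \<open>H'\<close> is
    bounded.\<close>
  obtain \<rho> where \<rho>: "\<rho> < R" "\<And>x. x \<in> K \<Longrightarrow> norm x \<le> \<rho>"
  proof (cases "K = {}")
    case True
    then show ?thesis using that[of "R - 1"] by simp
  next
    case False
    obtain y where "y \<in> K" "\<And>x. x \<in> K \<Longrightarrow> norm x \<le> norm y"
      using continuous_attains_sup[OF K(1) False, of norm] by (auto intro: continuous_intros)
    then show ?thesis using that[of "norm y"] K(2) by (auto simp: subset_iff)
  qed
  obtain C where C: "\<And>r. 0 \<le> r \<Longrightarrow> r \<le> \<rho> \<Longrightarrow> \<bar>H' r\<bar> \<le> C"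
  proof -
    have "continuous_on {0..\<rho>} H'"
      by (rule continuous_on_subset[OF H']) (use \<rho>(1) in auto)
    then have "bounded (H' ` {0..\<rho>})"
      by (intro compact_imp_bounded compact_continuous_image) auto
    then obtain C where "\<forall>r\<in>{0..\<rho>}. \<bar>H' r\<bar> \<le> C" by (auto simp: bounded_iff)
    then show ?thesis using that[of C] by auto
  qed
  \<comment> \<open>Linear growth at 0 keeps the quotient \<open>q\<close> bounded near the
    origin.\<close>
  have HC: "\<bar>H r\<bar> \<le> C * r" if r: "0 \<le> r" "r \<le> \<rho>" for r
  proof (cases "r = 0")
    case False
    obtain z where "0 < z" "z < r" "H r - H 0 = (r - 0) * H' z"
      using MVT2[of 0 r H H'] H r \<rho>(1) False by force
    then show ?thesis using C[of z] r H0 by (simp add: abs_mult mult.commute mult_right_mono)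
  qed (simp add: H0)
  define q where "q x = H (norm x) / norm x" for x :: 'a
  define E where "E b x = (if x = 0 then H' 0 else q x + (H' (norm x) - q x) * (x \<bullet> b)\<^sup>2 / (norm x)\<^sup>2)" for b x
  define \<psi> where "\<psi> x = \<bar>\<phi> x\<bar> powr p" for x
  define \<eta> where "\<eta> x = p * \<bar>\<phi> x\<bar> powr (p - 1) * sgn (\<phi> x)" for x
  \<comment> \<open>The derivative along \<open>b\<close> of the \<open>b\<close>-th component of
    \<open>\<psi>\<close> times the field. The field here is minus the \<open>F\<close> of the
    overview, so summing over the basis gives minus the divergence of
    \<open>\<bar>\<phi>\<bar> powr p * F\<close>.\<close>
  define D where "D b x = E b x * \<psi> x + q x * (x \<bullet> b) * (\<eta> x * (grad \<phi> x \<bullet> b))" for b x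
  have out: "\<psi> x = 0" "\<eta> x = 0" if "x \<notin> K" for x using K(3)[OF that] by (simp_all add: \<psi>_def \<eta>_def)
  have D_int: "integrable lborel (D b)" "integral\<^sup>L lborel (D b) = 0" if b: "b \<in> Basis" for b
  proof -
    let ?g = "\<lambda>x. q x * (x \<bullet> b) * \<psi> x"
    have cont: "continuous_on UNIV ?g"
    proof -
      have isc: "isCont (\<lambda>x. q x * (x \<bullet> b)) x" if "x \<in> ball 0 R" for x
      proof (cases "x = 0")
        case False
        have "isCont H (norm x)" using H[of "norm x"] that DERIV_isCont by auto
        then have "isCont (\<lambda>x. H (norm x)) x" by (intro isCont_o2[of x norm H]) auto
        then show ?thesis unfolding q_def using False by (intro continuous_intros) auto
      next
        case True
        have "R > 0" using that True by simp
        then have "isCont H 0" using H[of 0] DERIV_isCont by auto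
        moreover have "isCont norm (0::'a)" by (intro continuous_intros)
        ultimately have "isCont (\<lambda>x::'a. H (norm x)) 0" using isCont_o2[of "0::'a" norm H] by simp
        then have "((\<lambda>x::'a. H (norm x)) \<longlongrightarrow> 0) (at 0)" using H0 by (simp add: isCont_def)
        moreover have "norm (q x * (x \<bullet> b)) \<le> norm (H (norm x))" for x
          using Basis_le_norm[OF b, of x] mult_left_mono[of "\<bar>x \<bullet> b\<bar>" "norm x" "\<bar>H (norm x)\<bar>"]
          by (cases "x = 0") (auto simp: q_def abs_mult divide_simps)
        ultimately have "((\<lambda>x. q x * (x \<bullet> b)) \<longlongrightarrow> 0) (at 0)"
          using Lim_null_comparison tendsto_norm_zero_iff by (auto intro: tendsto_0_le[where K = 1])
        then show ?thesis using True by (simp add: isCont_def)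
      qed
      have "continuous_on (ball 0 R) (\<lambda>x. q x * (x \<bullet> b))"
        using isc by (intro continuous_at_imp_continuous_on) blast
      moreover have "continuous_on (ball 0 R) \<psi>"
        unfolding \<psi>_def[abs_def] using p
        by (intro continuous_on_powr' continuous_intros continuous_on_subset[OF c(1)]) auto
      ultimately have "continuous_on (ball 0 R) ?g" by (rule continuous_on_mult)
      moreover have "continuous_on (- K) ?g"
        by (rule continuous_on_eq[where f = "\<lambda>_. 0"]) (auto simp: out)
      ultimately have "continuous_on (ball 0 R \<union> - K) ?g"
        using K(1) by (intro continuous_on_open_Un) (auto simp: compact_imp_closed open_Compl)
      moreover have "ball 0 R \<union> - K = UNIV" using K(2) by auto
      ultimately show ?thesis by simp
    qed
    have der: "((\<lambda>t. ?g (x + t *\<^sub>R b)) has_real_derivative D b x) (at 0)" for x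
    proof (cases "x \<in> K")
      case True
      then have x: "norm x < R" using K(2) by auto
      have "((\<lambda>t. q (x + t *\<^sub>R b) * ((x + t *\<^sub>R b) \<bullet> b)) has_real_derivative E b x) (at 0)"
        using radial_field_directional_derivative[OF b H0 H[OF norm_ge_zero x]]
        by (cases "x = 0") (simp_all add: q_def E_def)
      moreover have "((\<lambda>t. \<psi> (x + t *\<^sub>R b)) has_real_derivative \<eta> x * (grad \<phi> x \<bullet> b)) (at 0)"
        using DERIV_chain2[OF abs_powr_has_derivative[OF p]
            has_directional_derivative[OF has_derivative_grad[OF test_function_Ck[OF \<phi>]], of x b]]
        by (simp add: \<psi>_def \<eta>_def)
      ultimately show ?thesis
        using DERIV_mult by (fastforce simp: D_def algebra_simps)
    next
      case False
      \<comment> \<open>Off the closed set \<open>K\<close> the product vanishes on a whole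
        neighbourhood, whatever \<open>H\<close> does beyond the ball.\<close>
      have "isCont (\<lambda>t. x + t *\<^sub>R b) 0" by (intro continuous_intros)
      then have "((\<lambda>t. x + t *\<^sub>R b) \<longlongrightarrow> x) (nhds 0)"
        using tendsto_at_iff_tendsto_nhds[of "\<lambda>t. x + t *\<^sub>R b" 0] by (simp add: isCont_def)
      moreover have "\<forall>\<^sub>F y in nhds x. y \<in> - K"
        using False K(1) by (intro eventually_nhds_in_open) (auto simp: compact_imp_closed open_Compl)
      ultimately have "\<forall>\<^sub>F t in nhds 0. x + t *\<^sub>R b \<in> - K"
        by (rule eventually_compose_filterlim[rotated])
      then have "\<forall>\<^sub>F t in nhds 0. ?g (x + t *\<^sub>R b) = 0"
        by (rule eventually_mono) (simp add: out)
      from DERIV_cong_ev[OF refl this refl, THEN iffD2, OF DERIV_const]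
      show ?thesis by (simp add: D_def out False)
    qed
    have bnd: "\<bar>D b x\<bar> \<le> 3 * C * B powr p + C * \<rho> * (p * B powr (p - 1) * B)" if xK: "x \<in> K" for x
    proof -
      note x = \<rho>(2)[OF xK]
      have C0: "C \<ge> 0" using C[of "norm x"] x by fastforce
      have qC: "\<bar>q x\<bar> \<le> C" using HC[of "norm x"] x C0 by (cases "x = 0") (auto simp: q_def divide_simps)
      have xb: "\<bar>x \<bullet> b\<bar> \<le> norm x" using Basis_le_norm[OF b] .
      have gb: "\<bar>grad \<phi> x \<bullet> b\<bar> \<le> B" using Basis_le_norm[OF b, of "grad \<phi> x"] B(2)[of x] by simp
      have "\<bar>E b x\<bar> \<le> 3 * C"
      proof (cases "x = 0")
        case False
        have "(x \<bullet> b)\<^sup>2 \<le> (norm x)\<^sup>2" using xb by (rule abs_le_square_iff[THEN iffD1, OF order_trans]) simp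
        then have "(x \<bullet> b)\<^sup>2 / (norm x)\<^sup>2 \<le> 1" using False by (simp add: divide_simps)
        then have "\<bar>(H' (norm x) - q x) * ((x \<bullet> b)\<^sup>2 / (norm x)\<^sup>2)\<bar> \<le> 2 * C * 1"
          unfolding abs_mult using qC C[of "norm x"] x by (intro mult_mono) auto
        then have "\<bar>q x + (H' (norm x) - q x) * ((x \<bullet> b)\<^sup>2 / (norm x)\<^sup>2)\<bar> \<le> 3 * C"
          using qC by linarith
        then show ?thesis using False by (simp add: E_def)
      qed (use C[of 0] x C0 in \<open>simp add: E_def\<close>)
      moreover have "0 \<le> \<psi> x" "\<psi> x \<le> B powr p" using B(1)[of x] p by (auto simp: \<psi>_def intro: powr_mono2)
      ultimately have "\<bar>E b x * \<psi> x\<bar> \<le> 3 * C * B powr p"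
        unfolding abs_mult using C0 by (intro mult_mono) auto
      moreover have "\<bar>q x * (x \<bullet> b) * (\<eta> x * (grad \<phi> x \<bullet> b))\<bar> \<le> C * \<rho> * (p * B powr (p - 1) * B)"
      proof -
        have "\<bar>\<eta> x\<bar> \<le> p * B powr (p - 1)"
          using p B(1)[of x] by (auto simp: \<eta>_def abs_mult sgn_if intro!: powr_mono2)
        then show ?thesis
          unfolding abs_mult using qC xb x gb p B0 C0 by (intro mult_mono) auto
      qed
      ultimately show ?thesis unfolding D_def by linarith
    qed
    \<comment> \<open>\<open>K\<close> may be empty, and then nothing prevents the constant from
      being negative; \<open>max 0\<close> covers the points off \<open>K\<close>, where
      \<open>D b\<close> is 0.\<close>
    have "\<bar>D b x\<bar> \<le> max 0 (3 * C * B powr p + C * \<rho> * (p * B powr (p - 1) * B))" for x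
      using bnd[of x] by (cases "x \<in> K") (auto simp: D_def out)
    from integral_directional_derivative_zero[OF cont K(1) _ der this]
    show "integrable lborel (D b)" "integral\<^sup>L lborel (D b) = 0" by (auto simp: out)
  qed
  \<comment> \<open>The barrier is assumed for positive radii only; the origin is a null set and is
    discarded when integrating.\<close>
  have ptw: "\<mu> * \<psi> x \<le> norm (grad \<phi> x) powr p + (\<Sum>b\<in>Basis. D b x)" if x0: "x \<noteq> 0" for x
  proof (cases "x \<in> K")
    case True
    let ?r = "norm x" and ?N = "real DIM('a)"
    have r: "0 < ?r" "?r < R" using x0 True K(2) by auto
    have s2: "(\<Sum>b\<in>Basis. (x \<bullet> b)\<^sup>2) = ?r\<^sup>2"
      unfolding power2_norm_eq_inner by (simp add: power2_eq_square flip: euclidean_inner)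
    have sx: "(\<Sum>b\<in>Basis. (x \<bullet> b) * (grad \<phi> x \<bullet> b)) = x \<bullet> grad \<phi> x"
      by (simp flip: euclidean_inner)
    have "(\<Sum>b\<in>Basis. E b x) = ?N * q x + (H' ?r - q x) / ?r\<^sup>2 * (\<Sum>b\<in>Basis. (x \<bullet> b)\<^sup>2)"
      using x0 by (simp add: E_def sum.distrib sum_distrib_left)
    also have "\<dots> = ?N * q x + (H' ?r - q x)"
      using x0 unfolding s2 by simp
    finally have sE: "(\<Sum>b\<in>Basis. E b x) = H' ?r + (?N - 1) * q x"
      by (simp add: algebra_simps)
    have sD: "(\<Sum>b\<in>Basis. D b x) = (H' ?r + (?N - 1) * q x) * \<psi> x + q x * \<eta> x * (x \<bullet> grad \<phi> x)"
      unfolding D_def sum.distrib sE[symmetric] sx[symmetric]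
      by (simp add: sum_distrib_left sum_distrib_right mult_ac)
    have "\<bar>q x * \<eta> x * (x \<bullet> grad \<phi> x)\<bar> \<le> p * \<bar>\<phi> x\<bar> powr (p - 1) * \<bar>H ?r\<bar> * norm (grad \<phi> x)"
    proof -
      have "\<bar>q x * \<eta> x * (x \<bullet> grad \<phi> x)\<bar> \<le> \<bar>q x\<bar> * (p * \<bar>\<phi> x\<bar> powr (p - 1)) * (?r * norm (grad \<phi> x))"
        unfolding abs_mult using p Cauchy_Schwarz_ineq2[of x "grad \<phi> x"]
        by (intro mult_mono) (auto simp: \<eta>_def abs_mult sgn_if)
      also have "\<dots> = (p * \<bar>\<phi> x\<bar> powr (p - 1)) * \<bar>H ?r\<bar> * norm (grad \<phi> x)"
        using x0 by (simp add: q_def)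
      finally show ?thesis .
    qed
    also have "\<dots> \<le> norm (grad \<phi> x) powr p + (p - 1) * \<bar>H ?r\<bar> powr (p / (p - 1)) * \<psi> x"
      unfolding \<psi>_def by (rule young_powr[OF p]) auto
    finally have 1: "- (q x * \<eta> x * (x \<bullet> grad \<phi> x)) \<le>
      norm (grad \<phi> x) powr p + (p - 1) * \<bar>H ?r\<bar> powr (p / (p - 1)) * \<psi> x" by linarith
    have "(\<mu> + (p - 1) * \<bar>H ?r\<bar> powr (p / (p - 1))) * \<psi> x \<le> (H' ?r + (?N - 1) * q x) * \<psi> x"
      using barrier[OF r] by (intro mult_right_mono) (auto simp: q_def \<psi>_def)
    then show ?thesis unfolding sD using 1 by (simp add: algebra_simps)
  qed (use p in \<open>simp add: out D_def\<close>)
  have i: "integrable lborel \<psi>" "integrable lborel (\<lambda>x. norm (grad \<phi> x) powr p)"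
    unfolding \<psi>_def[abs_def] using integrable_test_function[OF _ \<phi>] integrable_grad_test_function[OF _ \<phi>] p by auto
  have "(LINT x|lborel. \<mu> * \<psi> x) \<le> (LINT x|lborel. norm (grad \<phi> x) powr p + (\<Sum>b\<in>Basis. D b x))"
  proof (rule integral_mono_AE)
    show "AE x in lborel. \<mu> * \<psi> x \<le> norm (grad \<phi> x) powr p + (\<Sum>b\<in>Basis. D b x)"
      using AE_lborel_singleton[of 0] by eventually_elim (use ptw in auto)
  qed (use i D_int in auto)
  also have "\<dots> = (LINT x|lborel. norm (grad \<phi> x) powr p)"
    using i D_int by simp
  finally show ?thesis by (simp add: \<psi>_def[abs_def])
qed

section \<open>The generalized tangent\<close>

text \<open>A generalised arctangent: the antiderivative normalised at 0, with q = 2 the usual one.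
  Its limit is finite because \<open>q > 1\<close> makes the integrand integrable at
  infinity.\<close>

lemma arctan_p_exists:
  fixes q :: real
  assumes q: "q > 1"
  obtains T :: "real \<Rightarrow> real" and L :: real where
    "\<And>x. (T has_real_derivative 1 / (1 + \<bar>x\<bar> powr q)) (at x)" "T 0 = 0" "\<And>x. T (- x) = - T x"
    "(T \<longlongrightarrow> L) at_top" "\<And>x. \<bar>T x\<bar> < L"
proof -
  define f where "f x = 1 / (1 + \<bar>x\<bar> powr q)" for x :: real
  have pos: "1 + \<bar>x\<bar> powr q > 0" for x :: real by (smt (verit) powr_ge_zero)
  have fpos: "f x > 0" for x using pos by (simp add: f_def)
  have "isCont f x" for x
  proof -
    have "isCont (\<lambda>s. \<bar>s\<bar> powr q) x" using abs_powr_has_derivative[OF q] DERIV_isCont by blast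
    then have "isCont (\<lambda>s. 1 / (1 + \<bar>s\<bar> powr q)) x"
      using pos[of x] by (intro isCont_divide isCont_add continuous_const) auto
    then show ?thesis by (simp add: f_def[abs_def])
  qed
  then obtain F where F: "\<And>x. (F has_real_derivative f x) (at x)"
    using einterval_antiderivative[of "-\<infinity>" \<infinity> f] by (auto simp: has_real_derivative_iff_has_vector_derivative)
  define T where "T x = F x - F 0" for x
  have T: "(T has_real_derivative f x) (at x)" for x
    unfolding T_def[abs_def] using F by (auto intro!: derivative_eq_intros)
  have T0: "T 0 = 0" by (simp add: T_def)
  have odd: "T (- x) = - T x" for x
  proof -
    have "((\<lambda>x. T x + T (- x)) has_real_derivative f y + f (- y) * (- 1)) (at y)" for y
      by (intro DERIV_add T DERIV_chain2[where g = uminus]) (auto intro!: derivative_eq_intros)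
    then have "((\<lambda>x. T x + T (- x)) has_real_derivative 0) (at y)" for y
      by (simp add: f_def)
    from DERIV_isconst_all[OF allI[OF this], of x 0] show ?thesis using T0 by simp
  qed
  have mono: "T x < T y" if "x < y" for x y
    by (rule DERIV_pos_imp_increasing[OF that]) (use T fpos in blast)
  have bound: "T x \<le> T 1 + 1 / (q - 1)" for x
  proof (cases "x \<le> 1")
    case True
    then have "T x \<le> T 1" using mono[of x 1] by (cases "x = 1") auto
    then show ?thesis using q by (simp add: add_increasing2)
  next
    case False
    \<comment> \<open>The added term is the integral of y powr (- q) from \<open>x\<close> to
      infinity; it compensates the growth of \<open>T\<close>, so the sum is nonincreasing on
      \<open>x \<ge> 1\<close>.\<close>
    let ?S = "\<lambda>x. T x + x powr (1 - q) / (q - 1)"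
    have "?S x \<le> ?S 1"
    proof (rule DERIV_nonpos_imp_nonincreasing[where f = ?S])
      fix y assume y: "1 \<le> y" "y \<le> x"
      have "(?S has_real_derivative f y + (1 - q) * y powr (1 - q - 1) / (q - 1)) (at y)"
        using y by (intro DERIV_add T DERIV_cdivide) (auto intro!: derivative_eq_intros)
      moreover have "f y + (1 - q) * y powr (1 - q - 1) / (q - 1) \<le> 0"
      proof -
        have "(1 - q) * y powr (1 - q - 1) / (q - 1) = - (1 / y powr q)"
          using q y by (simp add: powr_minus divide_simps)
        moreover have "f y \<le> 1 / y powr q"
          using y unfolding f_def by (intro divide_left_mono) (auto intro!: mult_pos_pos add_pos_pos)
        ultimately show ?thesis by linarith
      qed
      ultimately show "\<exists>z. (?S has_real_derivative z) (at y) \<and> z \<le> 0" by blast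
    qed (use False in simp)
    moreover have "x powr (1 - q) / (q - 1) \<ge> 0" using q by simp
    ultimately show ?thesis by simp
  qed
  define L where "L = Sup (range T)"
  have bdd: "bdd_above (range T)" using bound by (auto intro!: bdd_aboveI[of _ "T 1 + 1 / (q - 1)"])
  have less: "T x < L" for x
    using mono[of x "x + 1"] cSup_upper[OF _ bdd, of "T (x + 1)"] by (auto simp: L_def)
  have lim: "(T \<longlongrightarrow> L) at_top"
  proof (rule increasing_tendsto)
    show "\<forall>\<^sub>F n in at_top. T n \<le> L" using less by (auto intro!: always_eventually less_imp_le)
    fix x assume "x < L"
    then obtain y where "x < T y" using less_cSup_iff[OF _ bdd] by (auto simp: L_def)
    have "x < T n" if "n \<ge> y" for n using that \<open>x < T y\<close> mono[of y n] by (cases "n = y") auto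
    then show "\<forall>\<^sub>F n in at_top. x < T n" by (auto simp: eventually_at_top_linorder)
  qed
  have "\<bar>T x\<bar> < L" for x using less[of x] less[of "- x"] odd[of x] by auto
  then show thesis using that[of T L] T T0 odd lim by (simp add: f_def)
qed

text \<open>Substitution y = (1 + s powr q) powr (- 1 / p), with inverse s = \<sigma> y on (0, 1):
  since 1 + (\<sigma> y) powr q = y powr (- p), the function \<open>A\<close> is an antiderivative
  of the integrand in \<open>pi_p\<close>. The ends y = 0 and y = 1 correspond to s = infinity and s
  = 0.\<close>

lemma pi_p_eq:
  fixes p q :: real
  assumes p: "p > 1" and q: "q = p / (p - 1)"
    and T: "\<And>x. (T has_real_derivative 1 / (1 + \<bar>x\<bar> powr q)) (at x)" and T0: "T 0 = 0"
    and lim: "(T \<longlongrightarrow> L) at_top"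
  shows "pi_p p = 2 * L / (p - 1)"
proof -
  define \<sigma> where "\<sigma> y = (y powr (- p) - 1) powr (1 / q)" for y :: real
  define A where "A y = - T (\<sigma> y) / (p - 1)" for y
  have q1: "q > 1" "1 / q = 1 - 1 / p" using p by (auto simp: q field_simps)
  have base: "y powr (- p) > 1" if "0 < y" "y < 1" for y :: real
    using powr_less_mono2_neg[of "-p" y 1] that p by simp
  have A: "(A has_real_derivative 1 / (1 - y powr p) powr (1 / p)) (at y)" if y: "0 < y" "y < 1" for y
  proof -
    let ?w = "y powr (- p) - 1"
    have w: "?w > 0" using base[OF y] by simp
    have "(\<sigma> has_real_derivative (1 / q) * ?w powr (1 / q - 1) * (- p * y powr (- p - 1))) (at y)"
      unfolding \<sigma>_def[abs_def] using y w by (auto intro!: derivative_eq_intros)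
    from DERIV_chain2[OF T this]
    have "((\<lambda>y. T (\<sigma> y)) has_real_derivative 
      1 / (1 + \<bar>\<sigma> y\<bar> powr q) * ((1 / q) * ?w powr (1 / q - 1) * (- p * y powr (- p - 1)))) (at y)" .
    then have "(A has_real_derivative
      - (1 / (1 + \<bar>\<sigma> y\<bar> powr q) * ((1 / q) * ?w powr (1 / q - 1) * (- p * y powr (- p - 1)))) / (p - 1)) (at y)"
      unfolding A_def[abs_def] by (intro DERIV_cdivide DERIV_minus)
    moreover have "- (1 / (1 + \<bar>\<sigma> y\<bar> powr q) * ((1 / q) * ?w powr (1 / q - 1) * (- p * y powr (- p - 1)))) / (p - 1)
      = 1 / (1 - y powr p) powr (1 / p)"
    proof -
      have 1: "1 + \<bar>\<sigma> y\<bar> powr q = y powr (- p)" using w q1(1) by (simp add: \<sigma>_def powr_powr)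
      have 2: "?w powr (1 / q - 1) = y / (1 - y powr p) powr (1 / p)"
      proof -
        have "?w = (1 - y powr p) * y powr (- p)" using y by (simp add: algebra_simps flip: powr_add)
        then have "?w powr (1 / q - 1) = (1 - y powr p) powr (- (1 / p)) * (y powr (- p)) powr (- (1 / p))"
          by (simp only: powr_mult q1(2)) simp
        also have "(y powr (- p)) powr (- (1 / p)) = y" using y p by (simp add: powr_powr)
        finally show ?thesis by (simp add: powr_minus divide_simps)
      qed
      have 3: "y powr (- p - 1) = y powr (- p) / y" using y by (simp add: powr_diff)
      have 4: "p / (q * (p - 1)) = 1" using p by (simp add: q)
      have 5: "- (1 / Y * (1 / q * (y / C) * (- p * (Y / y)))) / (p - 1) = p / (q * (p - 1)) * (1 / C)"
        if "Y \<noteq> 0" for Y C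
        using that y p q1(1) by (simp add: divide_simps)
      have "y powr (- p) \<noteq> 0" using y by simp
      from 5[OF this] show ?thesis unfolding 1 2 3 4 by simp
    qed
    ultimately show ?thesis by simp
  qed
  \<comment> \<open>The integrand is singular at 1; the nonnegative form of the fundamental theorem
    asks only for one-sided limits of \<open>A\<close> at the ends.\<close>
  have "(LBINT t=ereal 0..ereal 1. 1 / (1 - t powr p) powr (1 / p)) = 0 - (- L / (p - 1))"
  proof (rule interval_integral_FTC_nonneg(2)[where F = A])
    show "isCont (\<lambda>t. 1 / (1 - t powr p) powr (1 / p)) x" if "ereal 0 < ereal x" "ereal x < ereal 1" for x
    proof -
      have "x powr p < 1" using powr_less_mono2[of p x 1] that p by simp
      then show ?thesis using that p by (intro continuous_intros) auto
    qed
    have "filterlim \<sigma> at_top (at_right 0)" unfolding \<sigma>_def[abs_def] using p q1(1) by real_asymp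
    from filterlim_compose[OF lim this] have "(A \<longlongrightarrow> - L / (p - 1)) (at_right 0)"
      unfolding A_def[abs_def] using p by (intro tendsto_intros) auto
    then show "((A \<circ> real_of_ereal) \<longlongrightarrow> - L / (p - 1)) (at_right (ereal 0))"
      by (simp only: ereal_tendsto_simps1)
    have "(\<sigma> \<longlongrightarrow> 0) (at_left 1)" unfolding \<sigma>_def[abs_def] using p q1(1)
      by (intro tendsto_zero_powrI[where b = "1 / q"] tendsto_eq_intros)
        (auto simp: eventually_at_left_field intro!: exI[of _ 0] less_imp_le base)
    moreover have "isCont T 0" using T DERIV_isCont by blast
    ultimately have "((\<lambda>y. T (\<sigma> y)) \<longlongrightarrow> T 0) (at_left 1)" by (rule isCont_tendsto_compose[rotated])
    then have "(A \<longlongrightarrow> - T 0 / (p - 1)) (at_left 1)"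
      unfolding A_def[abs_def] using p by (intro tendsto_intros) auto
    then show "((A \<circ> real_of_ereal) \<longlongrightarrow> 0) (at_left (ereal 1))"
      using T0 by (simp add: ereal_tendsto_simps1)
  qed (use A in auto)
  then show ?thesis by (simp add: pi_p_def zero_ereal_def one_ereal_def)
qed

text \<open>Separation of variables: the inverse of the generalised arctangent solves the autonomous
  equation, and the finite limit of \<open>T\<close> at infinity becomes the blow-up point
  \<open>L\<close>.\<close>

lemma tan_p_exists:
  fixes p :: real
  assumes p: "p > 1"
  obtains \<tau> :: "real \<Rightarrow> real" and L :: real where
    "L > 0" "L = (p - 1) * pi_p p / 2" "\<tau> 0 = 0" "\<And>x. \<bar>x\<bar> < L \<Longrightarrow> \<tau> (- x) = - \<tau> x"
    "\<And>x. \<bar>x\<bar> < L \<Longrightarrow> (\<tau> has_real_derivative 1 + \<bar>\<tau> x\<bar> powr (p / (p - 1))) (at x)"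
    "filterlim \<tau> at_top (at_left L)"
proof -
  define q where "q = p / (p - 1)"
  have q: "q > 1" using p by (simp add: q_def field_simps)
  obtain T L where T: "\<And>x. (T has_real_derivative 1 / (1 + \<bar>x\<bar> powr q)) (at x)"
    and T0: "T 0 = 0" and odd: "\<And>x. T (- x) = - T x"
    and lim: "(T \<longlongrightarrow> L) at_top" and bnd: "\<And>x. \<bar>T x\<bar> < L"
    using arctan_p_exists[OF q] by metis
  have pos: "1 + \<bar>x\<bar> powr q > 0" for x :: real by (smt (verit) powr_ge_zero)
  have mono: "T x < T y" if "x < y" for x y
  proof (rule DERIV_pos_imp_increasing[OF that])
    show "\<exists>d. (T has_real_derivative d) (at z) \<and> d > 0" for z
      using T[of z] pos[of z] by (intro exI[of _ "1 / (1 + \<bar>z\<bar> powr q)"]) simp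
  qed
  have inj: "inj T" 
  proof (rule injI)
    show "x = y" if "T x = T y" for x y using mono[of x y] mono[of y x] that by (cases x y rule: linorder_cases) auto
  qed
  have contT: "isCont T x" for x using T DERIV_isCont by blast
  have L: "L > 0" using bnd[of 0] T0 by simp
  have ex: "\<exists>y. T y = x" if x: "\<bar>x\<bar> < L" for x
  proof -
    have "\<forall>\<^sub>F y in at_top. \<bar>x\<bar> < T y \<and> y \<ge> 0"
      using order_tendstoD(1)[OF lim x] eventually_ge_at_top[of 0] by eventually_elim auto
    then obtain y where y: "\<bar>x\<bar> < T y" "y \<ge> 0" using eventually_happens'[OF trivial_limit_at_top_linorder] by blast
    then have "T (- y) \<le> x" "x \<le> T y" using odd[of y] by auto
    then show ?thesis using IVT[of T "- y" x y] y(2) contT by auto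
  qed
  \<comment> \<open>Beyond the range (-L, L) of \<open>T\<close> the values of \<open>inv T\<close>
    are arbitrary; hence the condition \<open>\<bar>x\<bar> < L\<close> throughout.\<close>
  define \<tau> where "\<tau> = inv T"
  have \<tau>T: "\<tau> (T x) = x" for x by (simp add: \<tau>_def inj)
  have T\<tau>: "T (\<tau> x) = x" if "\<bar>x\<bar> < L" for x using ex[OF that] \<tau>T by metis
  have \<tau>0: "\<tau> 0 = 0" using \<tau>T[of 0] T0 by simp
  have \<tau>odd: "\<tau> (- x) = - \<tau> x" if "\<bar>x\<bar> < L" for x
    using \<tau>T[of "- \<tau> x"] odd[of "\<tau> x"] T\<tau>[OF that] by simp
  have der: "(\<tau> has_real_derivative 1 + \<bar>\<tau> x\<bar> powr q) (at x)" if x: "\<bar>x\<bar> < L" for x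
  proof -
    have "isCont \<tau> (T (\<tau> x))"
      by (rule isCont_inverse_function[where d = 1]) (auto simp: \<tau>T contT)
    then have cont: "isCont \<tau> x" by (simp add: T\<tau> x)
    have "(\<tau> has_real_derivative inverse (1 / (1 + \<bar>\<tau> x\<bar> powr q))) (at x)"
      by (rule DERIV_inverse_function[OF T, of _ x "- L" L]) (use x pos[of "\<tau> x"] cont T\<tau> in auto)
    then show ?thesis by simp
  qed
  have top: "filterlim \<tau> at_top (at_left L)"
    unfolding filterlim_at_top
  proof
    fix z
    show "\<forall>\<^sub>F x in at_left L. z \<le> \<tau> x"
    proof -
      have "\<forall>\<^sub>F x in at_left L. max 0 (T z) < x \<and> x < L"
        using bnd[of z] L by (auto simp: eventually_at_left_field intro!: exI[of _ "max 0 (T z)"])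
      then show ?thesis
      proof eventually_elim
        case (elim x)
        then have "T z < T (\<tau> x)" using T\<tau>[of x] by simp
        then show ?case using mono[of "\<tau> x" z] by linarith
      qed
    qed
  qed
  have "L = (p - 1) * pi_p p / 2"
    using pi_p_eq[OF p q_def T T0 lim] p by simp
  then show thesis using that[of L \<tau>] L \<tau>0 \<tau>odd der top by (simp add: q_def)
qed

section \<open>Upper bounds on an interval\<close>

lemma integral_pos_open:
  fixes g :: "'a::euclidean_space \<Rightarrow> real"
  assumes "open S" "S \<noteq> {}" "integrable lborel g" "\<And>x. 0 \<le> g x" "\<And>x. x \<in> S \<Longrightarrow> 0 < g x"
  shows "0 < integral\<^sup>L lborel g"
proof -
  have "integral\<^sup>L lborel g \<noteq> 0"
  proof
    assume "integral\<^sup>L lborel g = 0"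
    then have "AE x in lborel. g x = 0"
      using assms by (subst (asm) integral_nonneg_eq_0_iff_AE) auto
    then have "AE x in lborel. x \<notin> S"
      by eventually_elim (use assms(5) in force)
    then have "S \<in> null_sets lborel"
      using assms(1) by (subst (asm) AE_iff_null_sets[symmetric]) auto
    then have "negligible S"
      by (simp add: negligible_iff_null_sets null_sets_completionI)
    then show False using open_not_negligible[OF assms(1,2)] by blast
  qed
  then show ?thesis using assms(4) by (simp add: less_le)
qed

section \<open>Test functions obtained by integrating smooth odd functions\<close>

lemma grad_real: "grad \<phi> x = partial_deriv \<phi> 1 (x::real)"
  by (simp add: grad_def)

lemma Ck_antiderivative:
  fixes \<phi> \<psi> :: "real \<Rightarrow> real"
  assumes "\<And>x. (\<phi> has_real_derivative \<psi> x) (at x)" "\<And>k. Ck k \<psi>"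
  shows "Ck k \<phi>"
proof -
  have "Ck (Suc k) \<phi>"
    by (rule Ck_SucI) (use assms in \<open>auto simp: has_field_derivative_def\<close>)
  then show ?thesis by (rule Ck_mono_Suc)
qed

text \<open>Oddness makes the integral of \<open>\<psi>\<close> over [-r, r] vanish: the
  antiderivative that is 0 up to -r is even, hence 0 again from r on, and so has compact
  support.\<close>

lemma test_function_antiderivative:
  fixes \<psi> :: "real \<Rightarrow> real"
  assumes r: "0 < r" "r < R" and C: "\<And>k. Ck k \<psi>" and odd: "\<And>x. \<psi> (- x) = - \<psi> x"
    and out: "\<And>x. r \<le> \<bar>x\<bar> \<Longrightarrow> \<psi> x = 0"
  shows "\<exists>\<phi>. test_function {-R<..<R} \<phi> \<and> (\<forall>x. (\<phi> has_real_derivative \<psi> x) (at x)) \<and>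
    (\<forall>x. r \<le> \<bar>x\<bar> \<longrightarrow> \<phi> x = 0)"
proof -
  have "isCont \<psi> x" for x using Ck_continuous[OF C] by (simp add: continuous_on_eq_continuous_at)
  then obtain F where F: "\<And>x. (F has_real_derivative \<psi> x) (at x)"
    using einterval_antiderivative[of "-\<infinity>" \<infinity> \<psi>] by (auto simp: has_real_derivative_iff_has_vector_derivative)
  define \<phi> where "\<phi> x = F x - F (- r)" for x
  have \<phi>: "(\<phi> has_real_derivative \<psi> x) (at x)" for x
    unfolding \<phi>_def[abs_def] using F by (auto intro!: derivative_eq_intros)
  have even: "\<phi> (- x) = \<phi> x" for x
  proof -
    have "((\<lambda>x. \<phi> x - \<phi> (- x)) has_real_derivative \<psi> y - \<psi> (- y) * (- 1)) (at y)" for y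
      by (intro DERIV_diff \<phi> DERIV_chain2[where g = uminus]) (auto intro!: derivative_eq_intros)
    then have "((\<lambda>x. \<phi> x - \<phi> (- x)) has_real_derivative 0) (at y)" for y
      by (simp add: odd)
    from DERIV_isconst_all[OF allI[OF this], of x 0] show ?thesis by simp
  qed
  have left: "\<phi> x = 0" if "x \<le> - r" for x
  proof (cases "x = - r")
    case False
    then have "x < - r" using that by simp
    from MVT2[OF this, of \<phi> \<psi>] \<phi> obtain z where "z < - r" "\<phi> (- r) - \<phi> x = (- r - x) * \<psi> z" by blast
    moreover have "\<psi> z = 0" using \<open>z < - r\<close> r by (intro out) auto
    ultimately show ?thesis by (simp add: \<phi>_def)
  qed (simp add: \<phi>_def)
  have zero: "\<phi> x = 0" if "r \<le> \<bar>x\<bar>" for x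
    using left[of x] left[of "- x"] even[of x] that by (auto simp: abs_if split: if_splits)
  have "\<bar>x\<bar> < r" if "\<phi> x \<noteq> 0" for x using zero[of x] that by linarith
  then have "{x. \<phi> x \<noteq> 0} \<subseteq> {-r..r}" by (force simp: abs_less_iff)
  then have sub: "closure {x. \<phi> x \<noteq> 0} \<subseteq> {-r..r}" by (intro closure_minimal) auto
  then have "compact (closure {x. \<phi> x \<noteq> 0})"
    by (meson bounded_closed_interval bounded_subset closed_closure compact_eq_bounded_closed)
  moreover have "{-r..r} \<subseteq> {-R<..<R}" using r by auto
  ultimately have "test_function {-R<..<R} \<phi>"
    unfolding test_function_def using Ck_antiderivative[OF \<phi> C] sub by blast
  then show ?thesis using \<phi> zero by blast
qed

lemma flat_exp_one: "flat_exp 1 t = (if t > 0 then exp (- 1 / t) else 0)"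
  by (simp add: flat_exp_def)

text \<open>Weierstrass polynomials on slightly smaller intervals are replaced by their odd parts
  and multiplied by a smooth even cutoff, so smoothness is immediate and oddness is kept. The
  uniform bound \<open>M + 1\<close> later serves as majorant for dominated convergence.\<close>

lemma smooth_odd_approximation:
  fixes f :: "real \<Rightarrow> real"
  assumes R: "R > 0" and cont: "\<And>x. \<bar>x\<bar> < R \<Longrightarrow> isCont f x"
    and odd: "\<And>x. \<bar>x\<bar> < R \<Longrightarrow> f (- x) = - f x" and bound: "\<And>x. \<bar>x\<bar> < R \<Longrightarrow> \<bar>f x\<bar> \<le> M"
  shows "\<exists>(\<psi> :: nat \<Rightarrow> real \<Rightarrow> real) r. (\<forall>n. 0 < r n \<and> r n < R) \<and>
    (\<forall>n. (\<forall>k. Ck k (\<psi> n)) \<and> (\<forall>x. \<psi> n (- x) = - \<psi> n x) \<and> (\<forall>x. r n \<le> \<bar>x\<bar> \<longrightarrow> \<psi> n x = 0)) \<and>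
    (\<forall>n x. \<bar>\<psi> n x\<bar> \<le> M + 1) \<and> (\<forall>x. \<bar>x\<bar> < R \<longrightarrow> (\<lambda>n. \<psi> n x) \<longlonglongrightarrow> f x)"
proof -
  \<comment> \<open>\<open>Suc (Suc n)\<close> instead of \<open>Suc n\<close> keeps
    \<open>r 0\<close> positive.\<close>
  define r where "r n = R * (1 - inverse (real (Suc (Suc n))))" for n
  have r: "0 < r n" "r n < R" for n
  proof -
    let ?e = "inverse (real (Suc (Suc n)))"
    have "0 < ?e" "?e < 1" by (simp_all add: inverse_less_1_iff)
    then show "0 < r n" "r n < R"
      using R mult_pos_pos[of R "1 - ?e"] mult_pos_pos[of R ?e] by (simp_all only: r_def algebra_simps) auto
  qed
  have rlim: "r \<longlonglongrightarrow> R"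
  proof -
    have "(\<lambda>n. inverse (real (Suc (Suc n)))) \<longlonglongrightarrow> 0"
      by (rule LIMSEQ_Suc[OF LIMSEQ_inverse_real_of_nat])
    from tendsto_mult[OF tendsto_const tendsto_diff[OF tendsto_const this], of R 1]
    show ?thesis by (simp add: r_def[abs_def])
  qed
  have "\<exists>g. real_polynomial_function g \<and> (\<forall>x\<in>{-r n..r n}. \<bar>f x - g x\<bar> < inverse (real (Suc n)))" for n
  proof -
    have "continuous_on {-r n..r n} f"
      using cont r[of n] by (intro continuous_at_imp_continuous_on) auto
    then show ?thesis
      using Stone_Weierstrass_real_polynomial_function[of "{-r n..r n}" f "inverse (real (Suc n))"]
      by (metis compact_Icc inverse_positive_iff_positive of_nat_0_less_iff zero_less_Suc)
  qed
  then obtain g where g: "\<And>n. real_polynomial_function (g n)"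
    and gf: "\<And>n x. x \<in> {-r n..r n} \<Longrightarrow> \<bar>f x - g n x\<bar> < inverse (real (Suc n))" by metis
  \<comment> \<open>The odd part, written with sums and products by constants so that the
    introduction rules of \<open>real_polynomial_function\<close> apply directly.\<close>
  define q where "q n x = (g n x + (- 1) * g n (- x)) * (1/2)" for n x
  \<comment> \<open>The cutoff vanishes from \<open>r n\<close> on. The factor \<open>Suc n\<close>
    sends the argument of \<open>flat_exp\<close> to infinity at each \<open>x\<close> with
    \<open>\<bar>x\<bar> < R\<close>, so \<open>\<theta> n x\<close> tends to 1.\<close>
  define \<theta> where "\<theta> n x = flat_exp 1 (real (Suc n) * ((r n)\<^sup>2 - (norm x)\<^sup>2))" for n and x :: real
  define \<psi> where "\<psi> n x = \<theta> n x * q n x" for n x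
  have Cq: "Ck k (q n)" for k n
  proof -
    have "polynomial_function (\<lambda>x::real. - x)"
      by (intro polynomial_function_minus polynomial_function_id)
    from real_polynomial_function_compose[OF this g[of n]]
    have "real_polynomial_function (\<lambda>x. g n (- x))" by (simp add: comp_def)
    then have "real_polynomial_function (q n)"
      unfolding q_def[abs_def] using g[of n]
      by (intro real_polynomial_function.intros(2-4))
    then show ?thesis by (rule Ck_real_polynomial_function)
  qed
  have 1: "Ck k (\<psi> n)" for n k
    unfolding \<psi>_def[abs_def] \<theta>_def[abs_def] by (intro Ck_mult Ck_bump Cq)
  have 2: "\<psi> n (- x) = - \<psi> n x" for n x
    by (simp add: \<psi>_def \<theta>_def q_def algebra_simps)
  have \<theta>: "0 \<le> \<theta> n x" "\<theta> n x \<le> 1" for n x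
    by (auto simp: \<theta>_def flat_exp_one)
  have out: "\<theta> n x = 0" if "r n \<le> \<bar>x\<bar>" for n x
  proof -
    have "(r n)\<^sup>2 \<le> (norm x)\<^sup>2" using that r(1)[of n] by (simp add: abs_le_square_iff[symmetric])
    then have "real (Suc n) * ((r n)\<^sup>2 - (norm x)\<^sup>2) \<le> 0" by (intro mult_nonneg_nonpos) auto
    then show ?thesis unfolding \<theta>_def flat_exp_one by (simp only: not_less[symmetric] if_False)
  qed
  have qf: "\<bar>f x - q n x\<bar> \<le> inverse (real (Suc n))" if "\<bar>x\<bar> < r n" for n x
  proof -
    have "x \<in> {-r n..r n}" "- x \<in> {-r n..r n}" using that by auto
    then have "\<bar>f x - g n x\<bar> < inverse (real (Suc n))" "\<bar>f (- x) - g n (- x)\<bar> < inverse (real (Suc n))"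
      by (blast intro: gf)+
    moreover have "f (- x) = - f x" using that r(2)[of n] by (intro odd) auto
    moreover have "\<bar>a - (b + (- 1) * d) * (1/2)\<bar> \<le> e"
      if "\<bar>a - b\<bar> < e" "\<bar>c - d\<bar> < e" "c = - a" for a b c d e :: real
      using that by (auto simp: abs_le_iff abs_less_iff field_simps)
    ultimately show ?thesis unfolding q_def by blast
  qed
  have M0: "0 \<le> M" using bound[of 0] R by force
  have bnd: "\<bar>\<psi> n x\<bar> \<le> M + 1" for n x
  proof (cases "\<bar>x\<bar> < r n")
    case True
    have "inverse (real (Suc n)) \<le> 1" by (simp add: field_simps)
    then have "\<bar>q n x\<bar> \<le> M + 1" using qf[OF True] bound[of x] r(2)[of n] True by linarith
    then show ?thesis
      unfolding \<psi>_def abs_mult using \<theta>[of n x] mult_mono[of "\<bar>\<theta> n x\<bar>" 1 "\<bar>q n x\<bar>" "M + 1"] by simp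
  qed (use out[of n x] M0 in \<open>simp add: \<psi>_def\<close>)
  have lim: "(\<lambda>n. \<psi> n x) \<longlonglongrightarrow> f x" if x: "\<bar>x\<bar> < R" for x
  proof -
    have ev: "\<forall>\<^sub>F n in sequentially. \<bar>x\<bar> < r n" by (rule order_tendstoD(1)[OF rlim x])
    have "(\<lambda>n. q n x) \<longlonglongrightarrow> f x"
    proof (rule LIM_zero_cancel, rule Lim_null_comparison)
      show "\<forall>\<^sub>F n in sequentially. norm (q n x - f x) \<le> inverse (real (Suc n))"
        using ev by eventually_elim (use qf in \<open>simp add: abs_minus_commute\<close>)
    qed (rule LIMSEQ_inverse_real_of_nat)
    moreover have "(\<lambda>n. \<theta> n x) \<longlonglongrightarrow> 1"
    proof -
      have "(\<lambda>n. (r n)\<^sup>2 - (norm x)\<^sup>2) \<longlonglongrightarrow> R\<^sup>2 - (norm x)\<^sup>2"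
        by (intro tendsto_intros rlim)
      moreover have "R\<^sup>2 - (norm x)\<^sup>2 > 0" using power_strict_mono[of "norm x" R 2] x by simp
      moreover have "filterlim (\<lambda>n. real (Suc n)) at_top sequentially"
        by (rule filterlim_compose[OF filterlim_real_sequentially filterlim_Suc])
      ultimately have top: "filterlim (\<lambda>n. real (Suc n) * ((r n)\<^sup>2 - (norm x)\<^sup>2)) at_top sequentially"
        using filterlim_tendsto_pos_mult_at_top by (fastforce simp: mult.commute)
      have "((\<lambda>t. exp (- 1 / t)) \<longlongrightarrow> (1::real)) at_top" by real_asymp
      then have "(flat_exp 1 \<longlongrightarrow> 1) at_top"
        by (rule Lim_transform_eventually)
          (use eventually_gt_at_top[of 0] in \<open>auto elim!: eventually_mono simp: flat_exp_one\<close>)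
      from filterlim_compose[OF this top] show ?thesis by (simp only: \<theta>_def)
    qed
    ultimately show ?thesis unfolding \<psi>_def using tendsto_mult by force
  qed
  show ?thesis
    by (intro exI[of _ \<psi>] exI[of _ r] conjI allI impI 1 2 r bnd lim) (simp_all add: \<psi>_def out)
qed

lemma tendsto_abs_powr:
  fixes a p :: real
  assumes "(f \<longlongrightarrow> a) F" "p > 0"
  shows "((\<lambda>x. \<bar>f x\<bar> powr p) \<longlongrightarrow> \<bar>a\<bar> powr p) F"
  using assms by (intro tendsto_powr2 tendsto_intros) auto

text \<open>\<open>F\<close> enters as a trial function through its derivative \<open>f\<close>:
  smooth odd approximations of \<open>f\<close> integrate to test functions whose quotients
  converge, so membership of \<open>F\<close> in \<open>W01p\<close> does not have to be
  proved.\<close>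

lemma first_eigenvalue_interval_le:
  fixes f F :: "real \<Rightarrow> real"
  assumes p: "p > 0" and R: "R > 0" and cont: "\<And>x. \<bar>x\<bar> < R \<Longrightarrow> isCont f x"
    and odd: "\<And>x. \<bar>x\<bar> < R \<Longrightarrow> f (- x) = - f x" and bound: "\<And>x. \<bar>x\<bar> < R \<Longrightarrow> \<bar>f x\<bar> \<le> M"
    and F: "\<And>x. \<bar>x\<bar> < R \<Longrightarrow> (F has_real_derivative f x) (at x)" and F0: "(F \<longlongrightarrow> 0) (at_right (- R))"
    and nz: "(LINT x:{-R<..<R}|lborel. \<bar>F x\<bar> powr p) > 0"
  shows "first_eigenvalue p {-R<..<R} \<le>
    (LINT x:{-R<..<R}|lborel. \<bar>f x\<bar> powr p) / (LINT x:{-R<..<R}|lborel. \<bar>F x\<bar> powr p)"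
proof -
  let ?I = "{-R<..<R}"
  obtain \<psi> :: "nat \<Rightarrow> real \<Rightarrow> real" and r where r: "\<And>n. 0 < r n" "\<And>n. r n < R"
    and \<psi>: "\<And>n. (\<forall>k. Ck k (\<psi> n)) \<and> (\<forall>x. \<psi> n (- x) = - \<psi> n x) \<and> (\<forall>x. r n \<le> \<bar>x\<bar> \<longrightarrow> \<psi> n x = 0)"
    and bnd: "\<And>n x. \<bar>\<psi> n x\<bar> \<le> M + 1" and lim: "\<And>x. \<bar>x\<bar> < R \<Longrightarrow> (\<lambda>n. \<psi> n x) \<longlonglongrightarrow> f x"
    using smooth_odd_approximation[OF R cont odd bound] by blast
  have C: "Ck k (\<psi> n)" and \<psi>odd: "\<psi> n (- x) = - \<psi> n x" and out: "r n \<le> \<bar>x\<bar> \<Longrightarrow> \<psi> n x = 0" for n k x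
    using \<psi>[of n] by blast+
  have "\<forall>n. \<exists>\<phi>. test_function ?I \<phi> \<and> (\<forall>x. (\<phi> has_real_derivative \<psi> n x) (at x)) \<and> (\<forall>x. r n \<le> \<bar>x\<bar> \<longrightarrow> \<phi> x = 0)"
    using test_function_antiderivative[OF r C \<psi>odd out] by blast
  from choice[OF this] obtain \<phi> where \<phi>: "\<And>n. test_function ?I (\<phi> n)"
    and der: "\<And>n x. (\<phi> n has_real_derivative \<psi> n x) (at x)"
    and \<phi>out: "\<And>n x. r n \<le> \<bar>x\<bar> \<Longrightarrow> \<phi> n x = 0" by blast
  have M0: "0 \<le> M" using bound[of 0] R by force
  have \<psi>cont: "isCont (\<psi> n) x" for n x
    using Ck_continuous[OF C] by (simp add: continuous_on_eq_continuous_at)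
  have [measurable]: "\<psi> n \<in> borel_measurable borel" "\<phi> n \<in> borel_measurable borel" for n
    using Ck_continuous[OF C] Ck_continuous[OF test_function_Ck[OF \<phi>]]
    by (auto intro: borel_measurable_continuous_onI)
  \<comment> \<open>\<open>f\<close> is arbitrary off the interval. Cut off, it is a pointwise limit
    on the whole line, which also gives its measurability.\<close>
  define f0 where "f0 x = indicator ?I x * f x" for x
  have lim0: "(\<lambda>n. \<psi> n x) \<longlonglongrightarrow> f0 x" for x
  proof (cases "\<bar>x\<bar> < R")
    case True
    then show ?thesis using lim[OF True] by (auto simp: f0_def abs_less_iff)
  next
    case False
    then have "r n \<le> \<bar>x\<bar>" for n using r(2)[of n] by linarith
    moreover have "x \<notin> ?I" using False by auto
    ultimately show ?thesis by (simp add: f0_def out)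
  qed
  have f0_meas [measurable]: "f0 \<in> borel_measurable borel"
    by (rule borel_measurable_LIMSEQ_real[OF lim0]) simp
  have bnd0: "\<bar>f0 x\<bar> \<le> M + 1" for x using bound[of x] M0 by (auto simp: f0_def indicator_def abs_less_iff)
  have wint: "integrable lborel (\<lambda>y. c * indicator {a<..<b} y)" for a b c :: real
    by (intro integrable_mult_right integrable_real_indicator) (simp, cases "a \<le> b", auto)
  have lr: "(G \<longlongrightarrow> G y) (at y within S)" if "isCont G y" for G :: "real \<Rightarrow> real" and y S
    using continuous_at_imp_continuous_within[OF that] by (simp add: continuous_within)
  \<comment> \<open>Both functions are integrals of their derivatives from -R:
    \<open>\<phi> n\<close> is 0 there, and \<open>F\<close> has limit 0.\<close>
  have limF: "(\<lambda>n. \<phi> n x) \<longlonglongrightarrow> F x" if x: "\<bar>x\<bar> < R" for x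
  proof -
    let ?J = "{-R<..<x}"
    have e: "einterval (ereal (- R)) (ereal x) = ?J" by simp
    have xl: "- R < x" using x by auto
    have w: "integrable lborel (\<lambda>y. (M + 1) * indicator ?J y)" by (rule wint)
    have "(\<lambda>n. LINT y|lborel. indicator ?J y * \<psi> n y) \<longlonglongrightarrow> (LINT y|lborel. indicator ?J y * f0 y)"
      by (rule integral_dominated_convergence[OF _ _ w])
        (use bnd lim0 M0 in \<open>auto intro!: tendsto_mult simp: indicator_def\<close>)
    moreover have "(LINT y|lborel. indicator ?J y * \<psi> n y) = \<phi> n x" for n
    proof -
      have "integrable lborel (\<lambda>y. indicator ?J y * \<psi> n y)"
      proof (rule Bochner_Integration.integrable_bound[OF w])
        show "AE y in lborel. norm (indicator ?J y * \<psi> n y) \<le> norm ((M + 1) * indicator ?J y)"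
          using bnd[of n] M0 by (intro always_eventually allI) (simp add: indicator_def)
      qed measurable
      then have "set_integrable lborel ?J (\<psi> n)" by (simp add: set_integrable_def)
      then have si: "set_integrable lborel (einterval (ereal (- R)) (ereal x)) (\<psi> n)" by simp
      have "(LBINT y=ereal (- R)..ereal x. \<psi> n y) = \<phi> n x - \<phi> n (- R)"
      proof (rule interval_integral_FTC_integrable[OF _ _ _ si])
        show "(\<phi> n has_vector_derivative \<psi> n y) (at y)" for y
          using der by (simp add: has_real_derivative_iff_has_vector_derivative)
      qed (use xl \<psi>cont lr[OF DERIV_isCont[OF der]] in \<open>simp_all add: ereal_tendsto_simps1\<close>)
      moreover have "\<phi> n (- R) = 0" using \<phi>out r(2)[of n] R by simp
      ultimately show ?thesis
        using xl by (simp add: interval_lebesgue_integral_def set_lebesgue_integral_def)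
    qed
    moreover have "(LINT y|lborel. indicator ?J y * f0 y) = F x"
    proof -
      have eq: "indicator ?J y * f0 y = indicator ?J y * f y" for y
        using x by (auto simp: f0_def indicator_def)
      have "integrable lborel (\<lambda>y. indicator ?J y * f0 y)"
      proof (rule Bochner_Integration.integrable_bound[OF w])
        show "AE y in lborel. norm (indicator ?J y * f0 y) \<le> norm ((M + 1) * indicator ?J y)"
          using bnd0 M0 by (intro always_eventually allI) (simp add: indicator_def)
      qed measurable
      then have si: "set_integrable lborel (einterval (ereal (- R)) (ereal x)) f"
        by (simp add: set_integrable_def eq)
      have "(LBINT y=ereal (- R)..ereal x. f y) = F x - 0"
      proof (rule interval_integral_FTC_integrable[OF _ _ _ si])
        show "(F has_vector_derivative f y) (at y)" if "ereal (- R) < ereal y" "ereal y < ereal x" for y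
          using F[of y] that x by (simp add: has_real_derivative_iff_has_vector_derivative abs_less_iff)
        show "isCont f y" if "ereal (- R) < ereal y" "ereal y < ereal x" for y
          using cont[of y] that x by (simp add: abs_less_iff)
      qed (use xl F0 lr[OF DERIV_isCont[OF F[OF x]]] in \<open>simp_all add: ereal_tendsto_simps1\<close>)
      then show ?thesis
        using xl by (simp add: interval_lebesgue_integral_def set_lebesgue_integral_def eq)
    qed
    ultimately show ?thesis by simp
  qed
  define F1 where "F1 x = indicator ?I x * F x" for x
  have limF1: "(\<lambda>n. \<phi> n x) \<longlonglongrightarrow> F1 x" for x
  proof (cases "\<bar>x\<bar> < R")
    case True
    then show ?thesis using limF[OF True] by (auto simp: F1_def abs_less_iff)
  next
    case False
    then have "r n \<le> \<bar>x\<bar>" for n using r(2)[of n] by linarith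
    moreover have "x \<notin> ?I" using False by auto
    ultimately show ?thesis by (simp add: F1_def \<phi>out)
  qed
  have F1_meas [measurable]: "F1 \<in> borel_measurable borel"
    by (rule borel_measurable_LIMSEQ_real[OF limF1]) simp
  have \<phi>bnd: "\<bar>\<phi> n x\<bar> \<le> (M + 1) * (2 * R)" if x: "\<bar>x\<bar> < R" for n x
  proof -
    obtain z where "\<phi> n x - \<phi> n (- R) = (x - - R) * \<psi> n z"
      using MVT2[of "- R" x "\<phi> n" "\<psi> n"] der x by (metis abs_less_iff minus_less_iff)
    moreover have "\<phi> n (- R) = 0" using \<phi>out r(2)[of n] R by simp
    moreover have "\<bar>x - - R\<bar> * \<bar>\<psi> n z\<bar> \<le> (2 * R) * (M + 1)"
      using x bnd[of n z] by (intro mult_mono) auto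
    ultimately show ?thesis by (simp add: abs_mult mult.commute)
  qed
  have pw: "\<bar>indicator ?I x * y\<bar> powr p = indicator ?I x * \<bar>y\<bar> powr p" for x y
    using p by (simp add: indicator_def)
  have l1: "(\<lambda>n. LINT x|lborel. \<bar>\<phi> n x\<bar> powr p) \<longlonglongrightarrow> (LINT x|lborel. \<bar>F1 x\<bar> powr p)"
  proof (rule integral_dominated_convergence[OF _ _ wint[of "((M + 1) * (2 * R)) powr p" "- R" R]])
    show "AE x in lborel. norm (\<bar>\<phi> n x\<bar> powr p) \<le> ((M + 1) * (2 * R)) powr p * indicator ?I x" for n
    proof (intro always_eventually allI)
      fix x show "norm (\<bar>\<phi> n x\<bar> powr p) \<le> ((M + 1) * (2 * R)) powr p * indicator ?I x"
      proof (cases "\<bar>x\<bar> < R")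
        case True
        then show ?thesis using \<phi>bnd[OF True, of n] p by (auto intro!: powr_mono2 simp: abs_less_iff)
      next
        case False
        then have "r n \<le> \<bar>x\<bar>" using r(2)[of n] by linarith
        then show ?thesis by (simp add: \<phi>out)
      qed
    qed
  qed (auto intro!: always_eventually tendsto_abs_powr limF1 p)
  have l2: "(\<lambda>n. LINT x|lborel. \<bar>\<psi> n x\<bar> powr p) \<longlonglongrightarrow> (LINT x|lborel. \<bar>f0 x\<bar> powr p)"
  proof (rule integral_dominated_convergence[OF _ _ wint[of "(M + 1) powr p" "- R" R]])
    show "AE x in lborel. norm (\<bar>\<psi> n x\<bar> powr p) \<le> (M + 1) powr p * indicator ?I x" for n
    proof (intro always_eventually allI)
      fix x show "norm (\<bar>\<psi> n x\<bar> powr p) \<le> (M + 1) powr p * indicator ?I x"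
      proof (cases "\<bar>x\<bar> < R")
        case True
        then show ?thesis using bnd[of n x] p by (auto intro!: powr_mono2 simp: abs_less_iff)
      next
        case False
        then have "r n \<le> \<bar>x\<bar>" using r(2)[of n] by linarith
        then show ?thesis by (simp add: out)
      qed
    qed
  qed (auto intro!: always_eventually tendsto_abs_powr lim0 p)
  have eqF: "(LINT x|lborel. \<bar>F1 x\<bar> powr p) = (LINT x:?I|lborel. \<bar>F x\<bar> powr p)"
    and eqf: "(LINT x|lborel. \<bar>f0 x\<bar> powr p) = (LINT x:?I|lborel. \<bar>f x\<bar> powr p)"
    by (simp_all add: F1_def f0_def pw set_lebesgue_integral_def)
  have pd: "\<bar>grad (\<phi> n) x\<bar> = \<bar>\<psi> n x\<bar>" for n x
    using partial_deriv_eq[OF der[unfolded has_field_derivative_def]] by (simp add: grad_real)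
  have "(\<lambda>n. (LINT x|lborel. \<bar>\<psi> n x\<bar> powr p) / (LINT x|lborel. \<bar>\<phi> n x\<bar> powr p)) \<longlonglongrightarrow>
     (LINT x:?I|lborel. \<bar>f x\<bar> powr p) / (LINT x:?I|lborel. \<bar>F x\<bar> powr p)"
    using tendsto_divide[OF l2 l1] nz by (simp add: eqF eqf)
  then show ?thesis
  proof (rule tendsto_lowerbound)
    have "\<forall>\<^sub>F n in sequentially. 0 < (LINT x|lborel. \<bar>\<phi> n x\<bar> powr p)"
      using order_tendstoD(1)[OF l1, of 0] nz by (simp add: eqF)
    then show "\<forall>\<^sub>F n in sequentially. first_eigenvalue p ?I \<le>
      (LINT x|lborel. \<bar>\<psi> n x\<bar> powr p) / (LINT x|lborel. \<bar>\<phi> n x\<bar> powr p)"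
    proof eventually_elim
      case (elim n)
      then show ?case
        using first_eigenvalue_upper_bound[OF _ p \<phi>[of n]] by (simp add: pd)
    qed
  qed simp
qed

section \<open>Eigenvalues of intervals and balls\<close>

text \<open>The generalised tangent scaled to the given radius. The factor c = L / R moves the
  blow-up to \<open>R\<close>; with a = pi_p p / (2 * R) one has c = (p - 1) * a. The amplitude
  \<open>a powr (p - 1)\<close> makes the nonlinear term come out with coefficient p - 1, which
  leaves \<open>(p - 1) * a powr p\<close> as the constant.\<close>

lemma riccati_solution_exists:
  fixes p R :: real
  assumes p: "p > 1" and R: "R > 0"
  shows "\<exists>H. H 0 = 0 \<and> (\<forall>r. \<bar>r\<bar> < R \<longrightarrow> H (- r) = - H r) \<and> filterlim H at_top (at_left R) \<and>
    (\<forall>r. \<bar>r\<bar> < R \<longrightarrow> (H has_real_derivative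
      (p - 1) * (pi_p p / (2 * R)) powr p + (p - 1) * \<bar>H r\<bar> powr (p / (p - 1))) (at r))"
    and "pi_p p > 0"
proof -
  obtain \<tau> L where L: "L > 0" "L = (p - 1) * pi_p p / 2" and \<tau>0: "\<tau> 0 = 0"
    and \<tau>odd: "\<And>x. \<bar>x\<bar> < L \<Longrightarrow> \<tau> (- x) = - \<tau> x"
    and \<tau>der: "\<And>x. \<bar>x\<bar> < L \<Longrightarrow> (\<tau> has_real_derivative 1 + \<bar>\<tau> x\<bar> powr (p / (p - 1))) (at x)"
    and \<tau>top: "filterlim \<tau> at_top (at_left L)"
    using tan_p_exists[OF p] by metis
  show "pi_p p > 0" using L p by (simp add: zero_less_mult_iff)
  define c where "c = L / R"
  define a where "a = pi_p p / (2 * R)"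
  have c: "c > 0" using L(1) R by (simp add: c_def)
  have ca: "c = (p - 1) * a" unfolding c_def a_def L(2) by simp
  have a: "a > 0" using c ca p by (simp add: zero_less_mult_iff)
  define H where "H x = a powr (p - 1) * \<tau> (c * x)" for x
  have small: "\<bar>c * x\<bar> < L" if "\<bar>x\<bar> < R" for x
    using that L(1) R by (simp add: c_def abs_mult divide_simps mult.commute)
  have "(H has_real_derivative (p - 1) * a powr p + (p - 1) * \<bar>H r\<bar> powr (p / (p - 1))) (at r)"
    if r: "\<bar>r\<bar> < R" for r
  proof -
    have "(H has_real_derivative a powr (p - 1) * ((1 + \<bar>\<tau> (c * r)\<bar> powr (p / (p - 1))) * c)) (at r)"
      unfolding H_def[abs_def]
      by (intro DERIV_cmult DERIV_chain2[where f = \<tau> and g = "\<lambda>x. c * x", OF \<tau>der[OF small[OF r]]]) (auto intro!: derivative_eq_intros)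
    moreover have "\<bar>H r\<bar> powr (p / (p - 1)) = a powr p * \<bar>\<tau> (c * r)\<bar> powr (p / (p - 1))"
      using p by (simp add: H_def abs_mult powr_mult powr_powr)
    moreover have "a powr (p - 1) * ((1 + X) * c) = (p - 1) * a powr p + (p - 1) * (a powr p * X)" for X
      using a by (simp add: ca powr_diff field_simps)
    ultimately show ?thesis by simp
  qed
  moreover have "filterlim H at_top (at_left R)"
  proof -
    have "filterlim (\<lambda>x. c * x) (at_left L) (at_left R)"
      unfolding filterlim_at
    proof
      have "((\<lambda>x. c * x) \<longlongrightarrow> c * R) (at_left R)" by (intro tendsto_intros)
      then show "((\<lambda>x. c * x) \<longlongrightarrow> L) (at_left R)" using R by (simp add: c_def)
      have "c * x \<in> {..<L} \<and> c * x \<noteq> L" if "x < R" for x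
        using that mult_strict_left_mono[OF that c] R by (simp add: c_def)
      then show "\<forall>\<^sub>F x in at_left R. c * x \<in> {..<L} \<and> c * x \<noteq> L"
        unfolding eventually_at_filter by (intro always_eventually) blast
    qed
    from filterlim_compose[OF \<tau>top this]
    show ?thesis unfolding H_def using a by (intro filterlim_tendsto_pos_mult_at_top[OF tendsto_const]) auto
  qed
  moreover have "H (- r) = - H r" if "\<bar>r\<bar> < R" for r
    using \<tau>odd[OF small[OF that]] by (simp add: H_def)
  ultimately show "\<exists>H. H 0 = 0 \<and> (\<forall>r. \<bar>r\<bar> < R \<longrightarrow> H (- r) = - H r) \<and> filterlim H at_top (at_left R) \<and>
    (\<forall>r. \<bar>r\<bar> < R \<longrightarrow> (H has_real_derivative
      (p - 1) * (pi_p p / (2 * R)) powr p + (p - 1) * \<bar>H r\<bar> powr (p / (p - 1))) (at r))"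
    by (intro exI[of _ H]) (simp add: a_def[symmetric] H_def[of 0] \<tau>0)
qed

section \<open>The first eigenfunction of the interval\<close>

lemma set_integrable_bounded_continuous:
  fixes g :: "real \<Rightarrow> real"
  assumes "\<And>x. a < x \<Longrightarrow> x < b \<Longrightarrow> isCont g x" "\<And>x. a < x \<Longrightarrow> x < b \<Longrightarrow> \<bar>g x\<bar> \<le> B"
  shows "set_integrable lborel {a<..<b} g"
  unfolding set_integrable_def
proof (rule Bochner_Integration.integrable_bound)
  show "integrable lborel (\<lambda>x. B * indicator {a<..<b} x)"
    by (intro integrable_mult_right integrable_real_indicator) (simp, cases "a \<le> b", auto)
  have "continuous_on {a<..<b} g" using assms(1) by (intro continuous_at_imp_continuous_on) auto
  then show "(\<lambda>x. indicator {a<..<b} x *\<^sub>R g x) \<in> borel_measurable lborel"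
    using borel_measurable_continuous_on_indicator[of "{a<..<b}" g] by simp
  show "AE x in lborel. norm (indicator {a<..<b} x *\<^sub>R g x) \<le> norm (B * indicator {a<..<b} x)"
    using assms(2) by (intro always_eventually allI) (force simp: indicator_def)
qed

text \<open>\<open>sgn\<close> jumps at 0, but the power tends to 0 there. This gives continuity of
  the derivative of the eigenfunction where \<open>H\<close> vanishes.\<close>

lemma isCont_abs_powr_sgn:
  fixes s q :: real
  assumes "q > 0"
  shows "isCont (\<lambda>s. \<bar>s\<bar> powr q * sgn s) s"
proof (cases "s = 0")
  case False
  then show ?thesis by (intro continuous_intros) auto
next
  case True
  have "((\<lambda>s::real. \<bar>s\<bar> powr q) \<longlongrightarrow> 0) (at 0)"
    using assms tendsto_abs_powr[of "\<lambda>s. s" 0 "at 0" q] by simp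
  then have "((\<lambda>s::real. \<bar>s\<bar> powr q * sgn s) \<longlongrightarrow> 0) (at 0)"
    by (rule Lim_null_comparison[rotated]) (auto intro!: always_eventually simp: abs_mult sgn_if)
  then show ?thesis using True by (simp add: isCont_def)
qed

lemma eventually_abs_less_at_left: "R > 0 \<Longrightarrow> \<forall>\<^sub>F x in at_left R. \<bar>x\<bar> < (R::real)"
  by (auto simp: eventually_at_left_field intro!: exI[of _ 0])

text \<open>\<open>s\<close> encodes the parity, 1 for even and -1 for odd functions; limits at the
  left end then follow from those at the right end.\<close>

lemma tendsto_at_right_minus:
  fixes g :: "real \<Rightarrow> real"
  assumes "(g \<longlongrightarrow> l) (at_left R)" "R > 0" "\<And>x. \<bar>x\<bar> < R \<Longrightarrow> g (- x) = s * g x"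
  shows "(g \<longlongrightarrow> s * l) (at_right (- R))"
proof -
  have "((\<lambda>x. s * g x) \<longlongrightarrow> s * l) (at_left R)" by (intro tendsto_intros assms(1))
  moreover have "\<forall>\<^sub>F x in at_left R. s * g x = g (- x)"
    using eventually_abs_less_at_left[OF assms(2)] by eventually_elim (simp add: assms(3))
  ultimately have "((\<lambda>x. g (- x)) \<longlongrightarrow> s * l) (at_left R)"
    by (rule Lim_transform_eventually)
  then show ?thesis
    by (simp add: at_right_minus[of "- R"] filterlim_filtermap)
qed

text \<open>With \<open>W = H'\<close>, the first eigenfunction is \<open>v = W powr (- 1 / p)\<close>, and \<open>H / W\<close> is, up to sign,
  \<open>v * \<bar>v'\<bar> powr (p - 2) * v'\<close>. Its derivative \<open>\<lambda> * \<bar>v\<bar> powr p - \<bar>v'\<bar> powr p\<close> integrates to \<open>0\<close>.\<close>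

lemma first_eigenvalue_interval_upper:
  fixes H :: "real \<Rightarrow> real"
  assumes p: "p > 1" and R: "R > 0" and l: "l > 0"
    and Hodd: "\<And>r. \<bar>r\<bar> < R \<Longrightarrow> H (- r) = - H r" and Htop: "filterlim H at_top (at_left R)"
    and Hder: "\<And>r. \<bar>r\<bar> < R \<Longrightarrow> (H has_real_derivative l + (p - 1) * \<bar>H r\<bar> powr (p / (p - 1))) (at r)"
  shows "first_eigenvalue p {-R<..<R} \<le> l"
proof -
  let ?I = "{-R<..<R}"
  define q where "q = p / (p - 1)"
  have q: "q > 1" "(q - 1) * p = q" "(p - 1) * q = p" using p by (simp_all add: q_def field_simps)
  define W where "W x = l + (p - 1) * \<bar>H x\<bar> powr q" for x
  define v where "v x = W x powr (- (1 / p))" for x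
  \<comment> \<open>The derivative of \<open>v\<close>, as \<open>dv\<close> confirms; odd and
    bounded, as the approximation by smooth odd functions requires.\<close>
  define f where "f x = - (\<bar>H x\<bar> powr (q - 1) * sgn (H x)) * W x powr (- (1 / p))" for x
  have W: "W x \<ge> l" "W x > 0" "(p - 1) * \<bar>H x\<bar> powr q \<le> W x" for x
    using p l by (auto simp: W_def intro: add_pos_nonneg)
  have dH: "(H has_real_derivative W x) (at x)" if "\<bar>x\<bar> < R" for x
    using Hder[OF that] by (simp add: W_def q_def)
  have dHq: "((\<lambda>x. \<bar>H x\<bar> powr q) has_real_derivative q * \<bar>H x\<bar> powr (q - 1) * sgn (H x) * W x) (at x)"
    if "\<bar>x\<bar> < R" for x
    by (rule DERIV_chain2[OF abs_powr_has_derivative[OF q(1)] dH[OF that]])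
  have dW: "(W has_real_derivative p * \<bar>H x\<bar> powr (q - 1) * sgn (H x) * W x) (at x)" if "\<bar>x\<bar> < R" for x
  proof -
    have "(W has_real_derivative 0 + (p - 1) * (q * \<bar>H x\<bar> powr (q - 1) * sgn (H x) * W x)) (at x)"
      unfolding W_def[abs_def] by (intro DERIV_add DERIV_const DERIV_cmult dHq[OF that, unfolded W_def])
    also have "0 + (p - 1) * (q * \<bar>H x\<bar> powr (q - 1) * sgn (H x) * W x) =
        ((p - 1) * q) * \<bar>H x\<bar> powr (q - 1) * sgn (H x) * W x" by (simp add: mult_ac)
    finally show ?thesis by (simp only: q(3))
  qed
  have contH: "isCont H x" and contW: "isCont W x" if "\<bar>x\<bar> < R" for x
    using dH[OF that] dW[OF that] DERIV_isCont by blast+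
  have dv: "(v has_real_derivative f x) (at x)" if "\<bar>x\<bar> < R" for x
  proof -
    have "(v has_real_derivative - (1 / p) * W x powr (- (1 / p) - 1) * (p * \<bar>H x\<bar> powr (q - 1) * sgn (H x) * W x)) (at x)"
      unfolding v_def[abs_def] by (rule DERIV_chain2[OF has_real_derivative_powr[OF W(2)] dW[OF that]])
    also have "- (1 / p) * W x powr (- (1 / p) - 1) * (p * \<bar>H x\<bar> powr (q - 1) * sgn (H x) * W x) = f x"
      using W(2)[of x] p by (simp add: f_def powr_diff)
    finally show ?thesis .
  qed
  have vp: "\<bar>v x\<bar> powr p = 1 / W x" for x
    using W(2)[of x] p by (simp add: v_def powr_powr powr_neg_one)
  have fp: "\<bar>f x\<bar> powr p = \<bar>H x\<bar> powr q / W x" for x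
  proof (cases "H x = 0")
    case False
    then have "\<bar>f x\<bar> = \<bar>H x\<bar> powr (q - 1) * W x powr (- (1 / p))" by (simp add: f_def abs_mult sgn_if)
    then show ?thesis using W(2)[of x] p q(2)
      by (simp add: powr_mult powr_powr powr_neg_one)
  qed (use p q(1) in \<open>simp add: f_def\<close>)
  have fbound: "\<bar>f x\<bar> powr p \<le> 1 / (p - 1)" for x
    unfolding fp using W(2,3)[of x] p by (simp add: field_simps)
  have fbound': "\<bar>f x\<bar> \<le> (1 / (p - 1)) powr (1 / p)" for x
  proof -
    have "(\<bar>f x\<bar> powr p) powr (1 / p) \<le> (1 / (p - 1)) powr (1 / p)"
      using fbound p by (intro powr_mono2) auto
    then show ?thesis using p by (simp add: powr_powr)
  qed
  have contf: "isCont f x" if "\<bar>x\<bar> < R" for x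
  proof -
    have "isCont (\<lambda>x. \<bar>H x\<bar> powr (q - 1) * sgn (H x)) x"
      using isCont_o2[OF contH[OF that] isCont_abs_powr_sgn[of "q - 1"]] q(1) by simp
    from isCont_mult[OF isCont_minus[OF this] DERIV_isCont[OF dv[OF that]]]
    show ?thesis by (simp add: f_def[abs_def] v_def)
  qed
  have fodd: "f (- x) = - f x" if "\<bar>x\<bar> < R" for x
    using Hodd[OF that] by (simp add: f_def W_def)
  have veven: "v (- x) = 1 * v x" if "\<bar>x\<bar> < R" for x
    using Hodd[OF that] by (simp add: v_def W_def)
  have vlim: "(v \<longlongrightarrow> 0) (at_left R)"
  proof -
    have "filterlim (\<lambda>y::real. l + (p - 1) * \<bar>y\<bar> powr q) at_top at_top"
      using p q(1) by real_asymp
    from filterlim_compose[OF this Htop] have "filterlim W at_top (at_left R)" by (simp add: W_def[abs_def])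
    then show ?thesis unfolding v_def[abs_def] using p by (intro tendsto_neg_powr) auto
  qed
  have vlim': "(v \<longlongrightarrow> 0) (at_right (- R))"
    using tendsto_at_right_minus[OF vlim R veven] by simp
  define P where "P x = H x / W x" for x
  have dP: "(P has_real_derivative l * \<bar>v x\<bar> powr p - \<bar>f x\<bar> powr p) (at x)" if "\<bar>x\<bar> < R" for x
  proof -
    have "(P has_real_derivative (W x * W x - H x * (p * \<bar>H x\<bar> powr (q - 1) * sgn (H x) * W x)) / (W x * W x)) (at x)"
      unfolding P_def[abs_def] using W(2)[of x] by (intro DERIV_divide dH dW that) auto
    also have "H x * (p * \<bar>H x\<bar> powr (q - 1) * sgn (H x) * W x) = p * (\<bar>H x\<bar> * \<bar>H x\<bar> powr (q - 1)) * W x"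
      by (simp add: sgn_if)
    also have "\<bar>H x\<bar> * \<bar>H x\<bar> powr (q - 1) = \<bar>H x\<bar> powr q"
      by (cases "H x = 0") (simp_all add: powr_diff)
    also have "(W x * W x - p * \<bar>H x\<bar> powr q * W x) / (W x * W x) = (W x - p * \<bar>H x\<bar> powr q) / W x"
      using W(2)[of x] by (simp add: divide_simps algebra_simps)
    also have "\<dots> = l * \<bar>v x\<bar> powr p - \<bar>f x\<bar> powr p"
      unfolding vp fp by (simp add: W_def[of x] diff_divide_distrib[symmetric] algebra_simps)
    finally show ?thesis .
  qed
  have Plim: "(P \<longlongrightarrow> 0) (at_left R)"
  proof -
    \<comment> \<open>Since \<open>q > 1\<close>, the denominator outgrows the numerator:
      \<open>P\<close> vanishes at the ends although \<open>H\<close> blows up.\<close>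
    have "((\<lambda>y::real. y / (l + (p - 1) * \<bar>y\<bar> powr q)) \<longlongrightarrow> 0) at_top"
      using p q(1) by real_asymp
    from filterlim_compose[OF this Htop] show ?thesis by (simp add: P_def[abs_def] W_def)
  qed
  have Podd: "P (- x) = (- 1) * P x" if "\<bar>x\<bar> < R" for x
    using Hodd[OF that] by (simp add: P_def W_def)
  have Plim': "(P \<longlongrightarrow> 0) (at_right (- R))"
    using tendsto_at_right_minus[OF Plim R Podd] by simp
  have vint: "set_integrable lborel ?I (\<lambda>x. \<bar>v x\<bar> powr p)"
    unfolding vp
  proof (rule set_integrable_bounded_continuous)
    show "isCont (\<lambda>x. 1 / W x) x" if "- R < x" "x < R" for x
      using contW[of x] W(2)[of x] that by (intro isCont_divide continuous_const) auto
    show "\<bar>1 / W x\<bar> \<le> 1 / l" for x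
      using W(1,2)[of x] l frac_le[of 1 1 l "W x"] by simp
  qed
  have contfp: "isCont (\<lambda>x. \<bar>f x\<bar> powr p) x" if "\<bar>x\<bar> < R" for x
    using contf[OF that] p unfolding isCont_def by (intro tendsto_abs_powr) auto
  have fint: "set_integrable lborel ?I (\<lambda>x. \<bar>f x\<bar> powr p)"
    by (rule set_integrable_bounded_continuous[where B = "1 / (p - 1)"]) (use contfp fbound in auto)
  have "(LBINT x=ereal (- R)..ereal R. l * \<bar>v x\<bar> powr p - \<bar>f x\<bar> powr p) = 0 - 0"
  proof (rule interval_integral_FTC_integrable[where F = P])
    show "(P has_vector_derivative l * \<bar>v x\<bar> powr p - \<bar>f x\<bar> powr p) (at x)" 
      if "ereal (- R) < ereal x" "ereal x < ereal R" for x
      using dP[of x] that by (simp add: has_real_derivative_iff_has_vector_derivative abs_less_iff)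
    show "isCont (\<lambda>x. l * \<bar>v x\<bar> powr p - \<bar>f x\<bar> powr p) x"
      if "ereal (- R) < ereal x" "ereal x < ereal R" for x
      using that contfp[of x] contW[of x] W(2)[of x] unfolding vp
      by (intro isCont_diff isCont_mult isCont_divide continuous_const) (auto simp: abs_less_iff)
    show "set_integrable lborel (einterval (ereal (- R)) (ereal R)) (\<lambda>x. l * \<bar>v x\<bar> powr p - \<bar>f x\<bar> powr p)"
      using vint fint by simp
  qed (use R Plim Plim' in \<open>simp_all add: ereal_tendsto_simps1\<close>)
  then have "(LINT x:?I|lborel. l * \<bar>v x\<bar> powr p - \<bar>f x\<bar> powr p) = 0"
    using R by (simp add: interval_lebesgue_integral_def)
  then have energy: "(LINT x:?I|lborel. \<bar>f x\<bar> powr p) = l * (LINT x:?I|lborel. \<bar>v x\<bar> powr p)"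
    using vint fint by (simp add: set_integral_diff)
  have pos: "(LINT x:?I|lborel. \<bar>v x\<bar> powr p) > 0"
    unfolding set_lebesgue_integral_def
    by (rule integral_pos_open[of ?I]) (use R vint W(2) in \<open>auto simp: set_integrable_def vp indicator_def less_imp_le\<close>)
  have "first_eigenvalue p ?I \<le>
    (LINT x:?I|lborel. \<bar>f x\<bar> powr p) / (LINT x:?I|lborel. \<bar>v x\<bar> powr p)"
    by (rule first_eigenvalue_interval_le[OF _ R contf fodd fbound' dv vlim' pos]) (use p in simp)
  also have "\<dots> = l" using pos by (simp add: energy)
  finally show ?thesis .
qed

text \<open>A bump on the ball of half the radius, so that its closed support stays inside the open
  ball.\<close>

lemma ball_test_function_exists:
  assumes R: "R > 0" and p: "p > 0"
  shows "\<exists>\<psi> :: 'a::euclidean_space \<Rightarrow> real. test_function (ball 0 R) \<psi> \<and> (LINT x|lborel. \<bar>\<psi> x\<bar> powr p) \<noteq> 0"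
proof -
  define \<psi> :: "'a \<Rightarrow> real" where "\<psi> x = flat_exp 1 (1 * ((R / 2)\<^sup>2 - (norm x)\<^sup>2))" for x
  have out: "norm x \<le> R / 2" if "\<psi> x \<noteq> 0" for x
  proof (rule ccontr)
    assume "\<not> ?thesis"
    then have "(R / 2)\<^sup>2 \<le> (norm x)\<^sup>2" using R by (intro power_mono) auto
    then show False using that unfolding \<psi>_def flat_exp_one by simp
  qed
  have "closure {x. \<psi> x \<noteq> 0} \<subseteq> cball 0 (R / 2)"
    using out by (intro closure_minimal) auto
  moreover have "compact (closure {x. \<psi> x \<noteq> 0})"
    using calculation by (meson bounded_cball bounded_subset closed_closure compact_eq_bounded_closed)
  moreover have "cball 0 (R / 2) \<subseteq> ball (0::'a) R" using R by auto
  moreover have "Ck k \<psi>" for k unfolding \<psi>_def[abs_def] by (rule Ck_bump)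
  ultimately have test: "test_function (ball 0 R) \<psi>" unfolding test_function_def by blast
  have "0 < (LINT x|lborel. \<bar>\<psi> x\<bar> powr p)"
  proof (rule integral_pos_open)
    show "0 < \<bar>\<psi> x\<bar> powr p" if "x \<in> ball 0 (R / 2)" for x
    proof -
      have "(norm x)\<^sup>2 < (R / 2)\<^sup>2" using that by (intro power_strict_mono) auto
      then show ?thesis unfolding \<psi>_def flat_exp_one by simp
    qed
    show "integrable lborel (\<lambda>x. \<bar>\<psi> x\<bar> powr p)"
      by (rule integrable_test_function[OF open_ball test p])
  qed (use R in auto)
  then show ?thesis using test by auto
qed

text \<open>In dimension one the term with factor \<open>DIM - 1\<close> drops out of the barrier,
  and the equation for \<open>H\<close> satisfies it with equality.\<close>

lemma first_eigenvalue_interval_lower: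
  fixes H :: "real \<Rightarrow> real"
  assumes p: "p > 1" and R: "R > 0" and l: "l > 0" and H0: "H 0 = 0"
    and Hder: "\<And>r. \<bar>r\<bar> < R \<Longrightarrow> (H has_real_derivative l + (p - 1) * \<bar>H r\<bar> powr (p / (p - 1))) (at r)"
    and H'cont: "continuous_on {0..<R} (\<lambda>r. l + (p - 1) * \<bar>H r\<bar> powr (p / (p - 1)))"
  shows "l \<le> first_eigenvalue p {-R<..<R}"
proof -
  have I: "{-R<..<R} = ball 0 R" by (simp add: ball_eq_greaterThanLessThan)
  obtain \<psi> :: "real \<Rightarrow> real" where \<psi>: "test_function (ball 0 R) \<psi>" "(LINT x|lborel. \<bar>\<psi> x\<bar> powr p) \<noteq> 0"
    using ball_test_function_exists[OF R, of p] p by auto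
  show ?thesis unfolding I
  proof (rule first_eigenvalue_lower_bound[OF open_ball p _ _ \<psi>])
    show "l * (LINT x|lborel. \<bar>\<phi> x\<bar> powr p) \<le> (LINT x|lborel. norm (grad \<phi> x) powr p)"
      if "test_function (ball 0 R) \<phi>" for \<phi> :: "real \<Rightarrow> real"
      by (rule radial_barta_inequality[OF p that H0 Hder H'cont]) auto
  qed (use l in simp)
qed

text \<open>The radial field built from the one-dimensional solution \<open>H\<close> gives the constant
  \<open>l + (N - 1) * H r / r\<close>, which exceeds \<open>N * l\<close> except at the origin. Mixing in a small
  multiple of the field built from \<open>2 * l * r\<close> gains at the origin as well.\<close>

lemma first_eigenvalue_ball_gt:
  fixes H :: "real \<Rightarrow> real"
  assumes p: "p > 1" and R: "R > 0" and l: "l > 0" and H0: "H 0 = 0"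
    and Hder: "\<And>r. \<bar>r\<bar> < R \<Longrightarrow> (H has_real_derivative l + (p - 1) * \<bar>H r\<bar> powr (p / (p - 1))) (at r)"
    and H'cont: "continuous_on {0..<R} (\<lambda>r. l + (p - 1) * \<bar>H r\<bar> powr (p / (p - 1)))"
    and N: "DIM('a::euclidean_space) \<ge> 2"
  shows "real DIM('a) * l < first_eigenvalue p (ball (0::'a) R)"
proof -
  define q where "q = p / (p - 1)"
  have q: "q > 1" using p by (simp add: q_def field_simps)
  define W where "W r = l + (p - 1) * \<bar>H r\<bar> powr q" for r
  \<comment> \<open>The nonlinear term in the barrier of the linear field
    \<open>2 * l * r\<close>.\<close>
  define M where "M r = (p - 1) * (2 * l * r) powr q" for r
  let ?N = "real DIM('a)"
  have N2: "?N \<ge> 2" using N by simp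
  have dH: "(H has_real_derivative W r) (at r)" if "\<bar>r\<bar> < R" for r
    using Hder[OF that] by (simp add: W_def q_def)
  have Wl: "W r \<ge> l" for r using p by (simp add: W_def)
  have mvt: "\<exists>z. a < z \<and> z < b \<and> H b - H a = (b - a) * W z" if "0 \<le> a" "a < b" "b < R" for a b
    using MVT2[of a b H W] dH that by force
  have incr: "H b - H a \<ge> (b - a) * l" if ab: "0 \<le> a" "a \<le> b" "b < R" for a b
  proof (cases "a = b")
    case False
    then obtain z where "H b - H a = (b - a) * W z" using mvt[of a b] ab by auto
    then show ?thesis using Wl[of z] ab by (simp add: mult_left_mono)
  qed simp
  have Hl: "H r \<ge> r * l" if "0 \<le> r" "r < R" for r using incr[of 0 r] that H0 by simp
  have "((\<lambda>r. M r) \<longlongrightarrow> (p - 1) * 0) (at_right 0)"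
    unfolding M_def using q l
    by (intro tendsto_intros tendsto_zero_powrI[where b = q] tendsto_eq_intros)
      (auto simp: eventually_at_right_field intro!: exI[of _ 1])
  then have "\<forall>\<^sub>F r in at_right 0. M r < ?N * l / 2"
    using order_tendstoD(2)[of M "(p - 1) * 0" "at_right 0" "?N * l / 2"] l N2 by simp
  moreover have "\<forall>\<^sub>F r in at_right 0. 0 < r \<and> r < R"
    using R by (auto simp: eventually_at_right_field)
  ultimately have "\<forall>\<^sub>F r in at_right 0. M r < ?N * l / 2 \<and> 0 < r \<and> r < R"
    by eventually_elim auto
  \<comment> \<open>Up to \<open>r0\<close> the linear field leaves at least 2 N l - N l / 2 = 3/2 N
    l, a definite gain over N l.\<close>
  then obtain r0 where r0: "M r0 < ?N * l / 2" "0 < r0" "r0 < R"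
    using eventually_happens'[OF trivial_limit_at_right_real] by blast
  have Mmono: "M a \<le> M b" if "0 \<le> a" "a \<le> b" for a b
    unfolding M_def using p q l that by (intro mult_left_mono powr_mono2) auto
  \<comment> \<open>The lead of \<open>H\<close> at \<open>r0\<close> over its tangent line at 0; by
    \<open>incr\<close> it is never lost further out.\<close>
  define d where "d = H r0 - r0 * l"
  have d: "d > 0"
  proof -
    obtain z where z: "0 < z" "z < r0" "H r0 - H 0 = (r0 - 0) * W z" using mvt[of 0 r0] r0 by auto
    have "H z > 0" using Hl[of z] z r0 l mult_pos_pos[of z l] by linarith
    then have "W z > l" using p by (simp add: W_def)
    then show ?thesis using z(3) r0(2) H0 by (simp add: d_def)
  qed
  \<comment> \<open>From \<open>r0\<close> on the lead gives \<open>H r / r \<ge> l + d / R\<close>;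
    \<open>e\<close> is the resulting gain in the N - 1 tangential directions.\<close>
  define e where "e = (?N - 1) * (d / R)"
  have e: "e > 0" using d R N2 by (simp add: e_def)
  have M0: "M r \<ge> 0" for r using p by (simp add: M_def)
  \<comment> \<open>Beyond \<open>r0\<close> the mixing lowers the bound N l + e by at most
    \<open>t * S\<close>; \<open>t\<close> is chosen so that half of \<open>e\<close>
    survives.\<close>
  define S where "S = ?N * l + e + M R"
  have Nl: "?N * l > 0" using l N2 by simp
  have S: "S > 0" "S \<ge> e" using e M0[of R] Nl by (auto simp: S_def)
  define t where "t = e / (2 * S)"
  have t: "0 < t" "t < 1" "t * S = e / 2" using e S by (simp_all add: t_def divide_simps)
  \<comment> \<open>The first entry is the bound up to \<open>r0\<close>, the second the bound
    beyond it.\<close>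
  define \<mu> where "\<mu> = min (?N * l * (1 + t / 2)) (?N * l + e / 2)"
  have "?N * l < ?N * l * (1 + t / 2)"
    using mult_strict_left_mono[of 1 "1 + t / 2" "?N * l"] Nl t by simp
  then have \<mu>: "\<mu> > ?N * l" using e by (simp add: \<mu>_def)
  define k where "k r = (1 - t) * H r + t * (2 * l * r)" for r
  define k' where "k' r = (1 - t) * W r + t * (2 * l)" for r
  have dk: "(k has_real_derivative k' r) (at r)" if "0 \<le> r" "r < R" for r
    unfolding k_def[abs_def] k'_def using dH[of r] that
    by (auto intro!: derivative_eq_intros)
  have k'cont: "continuous_on {0..<R} k'"
    unfolding k'_def[abs_def] W_def q_def by (intro continuous_intros H'cont)
  have barrier: "\<mu> + (p - 1) * \<bar>k r\<bar> powr (p / (p - 1)) \<le> k' r + (?N - 1) * (k r / r)"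
    if r: "0 < r" "r < R" for r
  proof -
    have Hr: "H r \<ge> r * l" using Hl[of r] r by simp
    then have Hr0: "H r \<ge> 0" using mult_pos_pos[of r l] r l by linarith
    have kr: "k r \<ge> 0" using Hr0 r l t by (simp add: k_def)
    \<comment> \<open>By convexity the nonlinear term of the mixture is at most the mixture of the
      nonlinear terms, so the two barriers add up with weights 1 - t and t.\<close>
    have "\<bar>k r\<bar> powr q \<le> (1 - t) * H r powr q + t * (2 * l * r) powr q"
      using powr_convex_nonneg[of q "H r" "2 * l * r" t] kr q Hr0 r l t by (simp add: k_def)
    then have "(p - 1) * \<bar>k r\<bar> powr q \<le> (p - 1) * ((1 - t) * H r powr q + t * (2 * l * r) powr q)"
      using p by (intro mult_left_mono) auto
    also have "\<dots> = (1 - t) * ((p - 1) * H r powr q) + t * M r"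
      by (simp add: M_def algebra_simps)
    also have "(p - 1) * H r powr q = W r - l" using Hr0 by (simp add: W_def)
    finally have conv: "(p - 1) * \<bar>k r\<bar> powr q \<le> (1 - t) * (W r - l) + t * M r" .
    have kr_r: "k r / r = (1 - t) * (H r / r) + t * (2 * l)" using r by (simp add: k_def add_divide_distrib)
    have "k' r + (?N - 1) * ((1 - t) * h + t * (2 * l)) =
      (1 - t) * (W r + (?N - 1) * h) + t * (2 * (?N * l))" for h
      by (simp add: k'_def algebra_simps)
    from this[of "H r / r"] have "k' r + (?N - 1) * (k r / r) =
      (1 - t) * (W r + (?N - 1) * (H r / r)) + t * (2 * (?N * l))"
      by (simp only: kr_r)
    then have "k' r + (?N - 1) * (k r / r) - (p - 1) * \<bar>k r\<bar> powr q \<ge>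
      (1 - t) * (l + (?N - 1) * (H r / r)) + t * (2 * (?N * l) - M r)"
      using conv by (simp only: algebra_simps)
    moreover have "(1 - t) * (l + (?N - 1) * (H r / r)) + t * (2 * (?N * l) - M r) \<ge> \<mu>"
    proof (cases "r \<le> r0")
      case True
      have "H r / r \<ge> l" using Hr r by (simp add: pos_le_divide_eq mult.commute)
      then have "(?N - 1) * (H r / r) \<ge> (?N - 1) * l" using N2 by (intro mult_left_mono) auto
      then have "l + (?N - 1) * (H r / r) \<ge> ?N * l" by (simp add: algebra_simps)
      then have "(1 - t) * (l + (?N - 1) * (H r / r)) \<ge> (1 - t) * (?N * l)"
        using t by (intro mult_left_mono) auto
      moreover have "M r \<le> ?N * l / 2" using Mmono[of r r0] True r r0(1) by simp
      then have "3 / 2 * (?N * l) \<le> 2 * (?N * l) - M r" by linarith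
      then have "t * (2 * (?N * l) - M r) \<ge> t * (3 / 2 * (?N * l))"
        using t(1) by (rule mult_left_mono[OF _ less_imp_le])
      moreover have "(1 - t) * (?N * l) + t * (3 / 2 * (?N * l)) = ?N * l * (1 + t / 2)"
        by (simp add: field_simps)
      ultimately show ?thesis unfolding \<mu>_def by linarith
    next
      case False
      then have "H r - H r0 \<ge> (r - r0) * l" using incr[of r0 r] r r0 by simp
      then have "H r \<ge> r * l + d" by (simp add: d_def algebra_simps)
      then have "H r / r \<ge> (r * l + d) / r" using r by (intro divide_right_mono) auto
      moreover have "(r * l + d) / r = l + d / r" using r by (simp add: add_divide_distrib)
      moreover have "d / r \<ge> d / R" using r d by (intro divide_left_mono) auto
      ultimately have "H r / r \<ge> l + d / R" by linarith
      then have "(?N - 1) * (H r / r) \<ge> (?N - 1) * (l + d / R)" using N2 by (intro mult_left_mono) auto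
      then have "l + (?N - 1) * (H r / r) \<ge> ?N * l + e" by (simp add: e_def algebra_simps)
      then have "(1 - t) * (l + (?N - 1) * (H r / r)) \<ge> (1 - t) * (?N * l + e)"
        using t by (intro mult_left_mono) auto
      moreover have "t * (2 * (?N * l) - M r) \<ge> t * (- M R)"
        using t Mmono[of r R] r Nl by (intro mult_left_mono) auto
      moreover have "(1 - t) * (?N * l + e) + t * (- M R) = ?N * l + e - t * S"
        by (simp add: S_def algebra_simps)
      ultimately show ?thesis unfolding \<mu>_def using t(3) by linarith
    qed
    ultimately show ?thesis by (simp add: q_def)
  qed
  obtain \<psi> :: "'a \<Rightarrow> real" where \<psi>: "test_function (ball 0 R) \<psi>" "(LINT x|lborel. \<bar>\<psi> x\<bar> powr p) \<noteq> 0"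
    using ball_test_function_exists[OF R, of p] p by auto
  have "\<mu> \<le> first_eigenvalue p (ball (0::'a) R)"
  proof (rule first_eigenvalue_lower_bound[OF open_ball p _ _ \<psi>])
    show "\<mu> * (LINT x|lborel. \<bar>\<phi> x\<bar> powr p) \<le> (LINT x|lborel. norm (grad \<phi> x) powr p)"
      if "test_function (ball 0 R) \<phi>" for \<phi> :: "'a \<Rightarrow> real"
      by (rule radial_barta_inequality[OF p that _ dk k'cont barrier]) (simp_all add: k_def H0)
  qed (use \<mu> Nl in simp)
  then show ?thesis using \<mu> by simp
qed

theorem corollary1p3:
  fixes p R :: real
  assumes "CARD('n::finite) \<ge> 2" and "1 < p" and "0 < R"
  shows "first_eigenvalue p (ball (0 :: real ^ 'n) R)
           > real CARD('n) * first_eigenvalue p {-R<..<R}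
       \<and> real CARD('n) * first_eigenvalue p {-R<..<R}
           = real CARD('n) * (p - 1) * (pi_p p / (2 * R)) powr p"
proof -
  define l where "l = (p - 1) * (pi_p p / (2 * R)) powr p"
  have l: "l > 0" using riccati_solution_exists(2)[OF assms(2,3)] assms by (simp add: l_def)
  obtain H where H0: "H 0 = 0" and Hodd: "\<And>r. \<bar>r\<bar> < R \<Longrightarrow> H (- r) = - H r"
    and Htop: "filterlim H at_top (at_left R)"
    and Hder: "\<And>r. \<bar>r\<bar> < R \<Longrightarrow> (H has_real_derivative l + (p - 1) * \<bar>H r\<bar> powr (p / (p - 1))) (at r)"
    using riccati_solution_exists(1)[OF assms(2,3)] unfolding l_def by blast
  have H'cont: "continuous_on {0..<R} (\<lambda>r. l + (p - 1) * \<bar>H r\<bar> powr (p / (p - 1)))"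
  proof -
    have "isCont (\<lambda>r. \<bar>H r\<bar> powr (p / (p - 1))) r" if "0 \<le> r" "r < R" for r
      using DERIV_isCont[OF Hder[of r]] that assms(2)
      unfolding isCont_def by (intro tendsto_abs_powr) auto
    then have "continuous_on {0..<R} (\<lambda>r. \<bar>H r\<bar> powr (p / (p - 1)))"
      by (intro continuous_at_imp_continuous_on) auto
    then show ?thesis by (intro continuous_on_add continuous_on_mult continuous_on_const)
  qed
  have "first_eigenvalue p {-R<..<R} = l"
    using first_eigenvalue_interval_upper[OF assms(2,3) l Hodd Htop Hder]
      first_eigenvalue_interval_lower[OF assms(2,3) l H0 Hder H'cont] by simp
  moreover have "real DIM(real ^ 'n) * l < first_eigenvalue p (ball (0 :: real ^ 'n) R)"
    using assms(1) by (intro first_eigenvalue_ball_gt[OF assms(2,3) l H0 Hder H'cont]) auto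
  ultimately show ?thesis by (simp add: l_def)
qed

end
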